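(* Let $L$ be a transitive permutation group on a finite set $\Omega$ admitting a nontrivial block $B$ (that is, a block of imprimitivity with $1<|B|<|\Omega|$). If the pointwise stabiliser $L_{(\Omega\setminus B)}$ of $\Omega\setminus B$ in $L$ is nontrivial, then $L$ has exponential graph growth.
   Context: All groups and graphs are finite; graphs are simple (undirected, no loops or multiple edges). For a graph $\Gamma$, $V\Gamma$ is its vertex set and $\mathrm{Aut}(\Gamma)$ its automorphism group. For $G\le \mathrm{Aut}(\Gamma)$ and $v\in V\Gamma$, $G_v$ denotes the vertex-stabiliser and $G_v^{\Gamma(v)}$ the permutation group induced by $G_v$ on the neighbourhood $\Gamma(v)$ of $v$. If $\Gamma$ is connected, $G$ is transitive on $V\Gamma$, and $G_v^{\Gamma(v)}$ is permutation isomorphic to $L$ (this is independent of $v$), then $(\Gamma,G)$ is called a locally-$L$ pair. A permutation group $L$ has exponential graph growth if there exist a family of locally-$L$ pairs $\{(\Gamma_n,G_n)\}_{n\in\mathbb{N}}$ with $\lim_{n\to\infty}|V\Gamma_n|=\infty$ and a constant $c>1$ such that $|(G_n)_v|\ge c^{|V\Gamma_n|}$ for all $v\in V\Gamma_n$ and all $n\in\mathbb{N}$. For $S\subseteq\Omega$, $L_{(S)}$ denotes the pointwise stabiliser of $S$ in $L$. *)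

theory Defs
  imports
    "HOL-Algebra.Group_Action"
    "Graph_Theory.Graph_Theory"
    Complex_Main
begin

text \<open>
  A permutation group on \<open>\<Omega>\<close> is a subgroup \<open>L\<close> of \<^term>\<open>BijGroup \<Omega>\<close>. Its elements are functions
  that are extensional on \<open>\<Omega>\<close> (undefined outside \<open>\<Omega>\<close>), so distinct elements of \<open>L\<close> are distinct
  permutations of \<open>\<Omega>\<close> and \<^term>\<open>card L\<close> is the order of the group.
\<close>

abbreviation perm_group :: "'a set \<Rightarrow> ('a \<Rightarrow> 'a) set \<Rightarrow> ('a \<Rightarrow> 'a) monoid" where
  "perm_group \<Omega> L \<equiv> (BijGroup \<Omega>)\<lparr>carrier := L\<rparr>"

definition transitive_perm_group :: "'a set \<Rightarrow> ('a \<Rightarrow> 'a) set \<Rightarrow> bool" where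
  "transitive_perm_group \<Omega> L \<longleftrightarrow>
     subgroup L (BijGroup \<Omega>) \<and> transitive_action (perm_group \<Omega> L) \<Omega> (\<lambda>g. g)"

definition point_stab :: "'a set \<Rightarrow> ('a \<Rightarrow> 'a) set \<Rightarrow> 'a \<Rightarrow> ('a \<Rightarrow> 'a) set" where
  "point_stab \<Omega> L x = stabilizer (perm_group \<Omega> L) (\<lambda>g. g) x"

definition pointwise_stab :: "('a \<Rightarrow> 'a) set \<Rightarrow> 'a set \<Rightarrow> ('a \<Rightarrow> 'a) set" where
  "pointwise_stab L S = {g \<in> L. \<forall>x\<in>S. g x = x}"

definition block :: "'a set \<Rightarrow> ('a \<Rightarrow> 'a) set \<Rightarrow> 'a set \<Rightarrow> bool" where
  "block \<Omega> L B \<longleftrightarrow> B \<subseteq> \<Omega> \<and> B \<noteq> {} \<and> (\<forall>g\<in>L. g ` B = B \<or> g ` B \<inter> B = {})"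

definition nontrivial_block :: "'a set \<Rightarrow> ('a \<Rightarrow> 'a) set \<Rightarrow> 'a set \<Rightarrow> bool" where
  "nontrivial_block \<Omega> L B \<longleftrightarrow> block \<Omega> L B \<and> 1 < card B \<and> card B < card \<Omega>"

text \<open>The group induced by \<open>H\<close> on an \<open>H\<close>-invariant set \<open>S\<close>.\<close>

definition induced_perms :: "('a \<Rightarrow> 'a) set \<Rightarrow> 'a set \<Rightarrow> ('a \<Rightarrow> 'a) set" where
  "induced_perms H S = (\<lambda>g. restrict g S) ` H"

definition perm_isomorphic ::
    "'a set \<Rightarrow> ('a \<Rightarrow> 'a) set \<Rightarrow> 'b set \<Rightarrow> ('b \<Rightarrow> 'b) set \<Rightarrow> bool" where
  "perm_isomorphic \<Delta> M \<Omega> L \<longleftrightarrow>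
     (\<exists>f \<phi>. bij_betw f \<Delta> \<Omega> \<and> \<phi> \<in> iso (perm_group \<Delta> M) (perm_group \<Omega> L) \<and>
            (\<forall>g\<in>M. \<forall>x\<in>\<Delta>. f (g x) = \<phi> g (f x)))"

text \<open>
  Finite simple graphs are represented by \<^locale>\<open>pair_graph\<close>: finite loopless symmetric digraphs
  whose arcs are ordered pairs of vertices, an edge being a pair of opposite arcs.
\<close>

definition nbhd :: "'v pair_pre_digraph \<Rightarrow> 'v \<Rightarrow> 'v set" where
  "nbhd \<Gamma> v = {w. (v, w) \<in> parcs \<Gamma>}"

definition graph_automorphisms :: "'v pair_pre_digraph \<Rightarrow> ('v \<Rightarrow> 'v) set" where
  "graph_automorphisms \<Gamma> =
     {g \<in> Bij (pverts \<Gamma>). \<forall>u\<in>pverts \<Gamma>. \<forall>v\<in>pverts \<Gamma>. (u, v) \<in> parcs \<Gamma> \<longleftrightarrow> (g u, g v) \<in> parcs \<Gamma>}"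

definition graph_Aut :: "'v pair_pre_digraph \<Rightarrow> ('v \<Rightarrow> 'v) monoid" where
  "graph_Aut \<Gamma> = perm_group (pverts \<Gamma>) (graph_automorphisms \<Gamma>)"

lemma subgroup_graph_automorphisms:
  "subgroup (graph_automorphisms \<Gamma>) (BijGroup (pverts \<Gamma>))"
proof -
  let ?V = "pverts \<Gamma>"
  interpret B: group "BijGroup ?V" by (rule group_BijGroup)
  show ?thesis
  proof (rule B.subgroupI)
    show "graph_automorphisms \<Gamma> \<subseteq> carrier (BijGroup ?V)"
      by (auto simp: graph_automorphisms_def BijGroup_def)
    have "(\<lambda>x\<in>?V. x) \<in> graph_automorphisms \<Gamma>"
      by (auto simp: graph_automorphisms_def id_Bij)
    then show "graph_automorphisms \<Gamma> \<noteq> {}" by auto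
  next
    fix g assume g: "g \<in> graph_automorphisms \<Gamma>"
    then have gB: "g \<in> Bij ?V" by (simp add: graph_automorphisms_def)
    have g': "restrict (inv_into ?V g) ?V \<in> Bij ?V"
      by (rule restrict_inv_into_Bij[OF gB])
    have "inv\<^bsub>BijGroup ?V\<^esub> g = restrict (inv_into ?V g) ?V"
      by (rule inv_BijGroup[OF gB])
    moreover have "g (inv_into ?V g x) = x" "inv_into ?V g x \<in> ?V" if "x \<in> ?V" for x
      using gB that by (auto simp: Bij_def bij_betw_def f_inv_into_f inv_into_into)
    ultimately show "inv\<^bsub>BijGroup ?V\<^esub> g \<in> graph_automorphisms \<Gamma>"
      using g g' by (simp add: graph_automorphisms_def)
  next
    fix g h assume "g \<in> graph_automorphisms \<Gamma>" "h \<in> graph_automorphisms \<Gamma>"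
    then show "g \<otimes>\<^bsub>BijGroup ?V\<^esub> h \<in> graph_automorphisms \<Gamma>"
      using Bij_imp_funcset[of h ?V]
      by (auto simp: graph_automorphisms_def BijGroup_def compose_Bij compose_eq Pi_iff)
  qed
qed

lemma group_graph_Aut: "group (graph_Aut \<Gamma>)"
  unfolding graph_Aut_def
  by (rule group.subgroup_imp_group[OF group_BijGroup subgroup_graph_automorphisms])

definition locally_pair ::
    "'a set \<Rightarrow> ('a \<Rightarrow> 'a) set \<Rightarrow> 'v pair_pre_digraph \<Rightarrow> ('v \<Rightarrow> 'v) set \<Rightarrow> bool" where
  "locally_pair \<Omega> L \<Gamma> G \<longleftrightarrow>
     pair_graph \<Gamma> \<and> Digraph_Component.connected (with_proj \<Gamma>) \<and>
     subgroup G (graph_Aut \<Gamma>) \<and> transitive_perm_group (pverts \<Gamma>) G \<and>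
     (\<forall>v\<in>pverts \<Gamma>.
        perm_isomorphic (nbhd \<Gamma> v) (induced_perms (point_stab (pverts \<Gamma>) G v) (nbhd \<Gamma> v)) \<Omega> L)"

text \<open>
  Taking the vertices to be natural numbers is no restriction, since every finite graph is
  isomorphic to one of this kind; the type must be fixed because one cannot quantify over types
  inside a definition.
\<close>

definition exponential_graph_growth :: "'a set \<Rightarrow> ('a \<Rightarrow> 'a) set \<Rightarrow> bool" where
  "exponential_graph_growth \<Omega> L \<longleftrightarrow>
     (\<exists>(\<Gamma> :: nat \<Rightarrow> nat pair_pre_digraph) (G :: nat \<Rightarrow> (nat \<Rightarrow> nat) set).
        (\<forall>n. locally_pair \<Omega> L (\<Gamma> n) (G n)) \<and>
        filterlim (\<lambda>n. card (pverts (\<Gamma> n))) at_top sequentially \<and>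
        (\<exists>c::real. c > 1 \<and>
           (\<forall>n. \<forall>v\<in>pverts (\<Gamma> n).
              real (card (point_stab (pverts (\<Gamma> n)) (G n) v)) \<ge> c ^ card (pverts (\<Gamma> n)))))"

end

theory Submission
  imports Defs
begin

text \<open>
  Let \<open>\<Sigma>\<close> be the block system of \<open>B\<close>. The complete bipartite graph on two copies of \<open>\<Omega>\<close> is a
  locally-\<open>L\<close> graph for \<open>L\<close> wr \<open>C\<^sub>2\<close>, and points in the same block of the same copy have the same
  neighbours. It has a regular cover with group \<open>(\<int>/m)\<^bsup>\<Sigma> \<times> \<Sigma>\<^esup>\<close> in which an edge joining blocks
  \<open>\<sigma>\<close> and \<open>\<tau>\<close> has as voltage the unit vector at \<open>(\<sigma>, \<tau>)\<close>. The voltages are permuted by \<open>L\<close> wr \<open>C\<^sub>2\<close>,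
  so this group lifts, and since they only depend on blocks, the vertices over a block still have
  the same neighbours. Hence on each of these fibres one may act, independently of the others, by a
  conjugate of a nontrivial element of the pointwise stabiliser of \<open>\<Omega> - B\<close> in \<open>L\<close>, without leaving the
  group of all automorphisms that act on every neighbourhood, read in \<open>\<Omega>\<close> through the covering
  map, as an element of \<open>L\<close>. The number of fibres is linear in the number of vertices, so vertex
  stabilisers in this group are exponentially large. The cover may be disconnected, but its
  components grow with \<open>m\<close>.
\<close>

subsection \<open>Universal groups of colourings\<close>

lemma Bij_mult: "f \<in> Bij S \<Longrightarrow> g \<in> Bij S \<Longrightarrow> f \<otimes>\<^bsub>BijGroup S\<^esub> g = compose S f g"
  by (simp add: BijGroup_def)

lemma Bij_mem: "f \<in> Bij S \<Longrightarrow> x \<in> S \<Longrightarrow> f x \<in> S"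
  using Bij_imp_funcset by fastforce

lemma subgroup_BijGroupD:
  assumes "subgroup L (BijGroup \<Omega>)"
  shows "L \<subseteq> Bij \<Omega>" and "(\<lambda>x\<in>\<Omega>. x) \<in> L"
    and "\<And>f g. f \<in> L \<Longrightarrow> g \<in> L \<Longrightarrow> compose \<Omega> f g \<in> L"
    and "\<And>f. f \<in> L \<Longrightarrow> restrict (inv_into \<Omega> f) \<Omega> \<in> L"
proof -
  show sub: "L \<subseteq> Bij \<Omega>"
    using subgroup.subset[OF assms] by (simp add: BijGroup_def)
  show "(\<lambda>x\<in>\<Omega>. x) \<in> L"
    using subgroup.one_closed[OF assms] by (simp add: BijGroup_def)
  show "compose \<Omega> f g \<in> L" if "f \<in> L" "g \<in> L" for f g
    using subgroup.m_closed[OF assms that] that sub by (simp add: Bij_mult subsetD)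
  show "restrict (inv_into \<Omega> f) \<Omega> \<in> L" if "f \<in> L" for f
    using subgroup.m_inv_closed[OF assms that] that sub by (simp add: inv_BijGroup subsetD)
qed

lemma subgroup_BijGroup_inverse:
  assumes "subgroup L (BijGroup \<Omega>)" "g \<in> L"
  obtains g' where "g' \<in> L" "\<And>x. x \<in> \<Omega> \<Longrightarrow> g' (g x) = x" "\<And>x. x \<in> \<Omega> \<Longrightarrow> g (g' x) = x"
proof
  have "bij_betw g \<Omega> \<Omega>"
    using assms subgroup_BijGroupD(1) by (auto simp: Bij_def)
  then show "restrict (inv_into \<Omega> g) \<Omega> (g x) = x" "g (restrict (inv_into \<Omega> g) \<Omega> x) = x"
    if "x \<in> \<Omega>" for x
    using that by (simp_all add: bij_betw_apply bij_betw_inv_into_left bij_betw_inv_into_right)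
qed (rule subgroup_BijGroupD(4)[OF assms])

text \<open>A finite analogue of a Burger-Mozes universal group, with the colours on the vertices.
  The element \<open>l\<close> may vary with \<open>v\<close>: only the action on each single
  neighbourhood is prescribed to lie in \<open>L\<close>.\<close>

definition universal_group ::
    "('v \<Rightarrow> 'a) \<Rightarrow> ('a \<Rightarrow> 'a) set \<Rightarrow> 'v pair_pre_digraph \<Rightarrow> ('v \<Rightarrow> 'v) set" where
  "universal_group p L \<Gamma> =
     {g \<in> graph_automorphisms \<Gamma>. \<forall>v\<in>pverts \<Gamma>. \<exists>l\<in>L. \<forall>w\<in>nbhd \<Gamma> v. p (g w) = l (p w)}"

lemma (in pair_graph) nbhd_subset: "nbhd G v \<subseteq> pverts G"
  by (auto simp: nbhd_def in_arcsD2)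

lemma graph_automorphisms_nbhd:
  assumes "pair_graph \<Gamma>" "g \<in> graph_automorphisms \<Gamma>" "v \<in> pverts \<Gamma>"
  shows "g ` nbhd \<Gamma> v = nbhd \<Gamma> (g v)"
proof -
  interpret pair_graph \<Gamma> by fact
  have gB: "g \<in> Bij (pverts \<Gamma>)" and
    e: "\<And>u w. u \<in> pverts \<Gamma> \<Longrightarrow> w \<in> pverts \<Gamma> \<Longrightarrow> (u, w) \<in> parcs \<Gamma> \<longleftrightarrow> (g u, g w) \<in> parcs \<Gamma>"
    using assms(2) by (auto simp: graph_automorphisms_def)
  have surj: "g ` pverts \<Gamma> = pverts \<Gamma>"
    using gB by (auto simp: Bij_def bij_betw_def)
  show ?thesis
  proof
    show "g ` nbhd \<Gamma> v \<subseteq> nbhd \<Gamma> (g v)"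
      using e assms(3) nbhd_subset by (fastforce simp: nbhd_def)
    show "nbhd \<Gamma> (g v) \<subseteq> g ` nbhd \<Gamma> v"
    proof
      fix w assume w: "w \<in> nbhd \<Gamma> (g v)"
      then obtain u where "u \<in> pverts \<Gamma>" "w = g u"
        using surj nbhd_subset by blast
      then show "w \<in> g ` nbhd \<Gamma> v"
        using w e assms(3) by (auto simp: nbhd_def)
    qed
  qed
qed

text \<open>Local actions obey a cocycle rule: the one of \<open>g h\<close> at \<open>v\<close> is
  the product of the one of \<open>g\<close> at \<open>h v\<close> and the one of \<open>h\<close>
  at \<open>v\<close>. So closure of \<open>L\<close> under products and inverses passes to the
  universal group.\<close>

lemma subgroup_universal_group:
  assumes \<Gamma>: "pair_graph \<Gamma>" and L: "subgroup L (BijGroup \<Omega>)"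
    and p: "\<And>v. v \<in> pverts \<Gamma> \<Longrightarrow> p ` nbhd \<Gamma> v \<subseteq> \<Omega>"
  shows "subgroup (universal_group p L \<Gamma>) (graph_Aut \<Gamma>)"
proof -
  interpret \<Gamma>: pair_graph \<Gamma> by fact
  let ?V = "pverts \<Gamma>"
  let ?U = "universal_group p L \<Gamma>"
  note LD = subgroup_BijGroupD[OF L]
  interpret A: group "graph_Aut \<Gamma>" by (rule group_graph_Aut)
  have UA: "?U \<subseteq> graph_automorphisms \<Gamma>" by (auto simp: universal_group_def)
  have autB: "graph_automorphisms \<Gamma> \<subseteq> Bij ?V" by (auto simp: graph_automorphisms_def)
  show ?thesis
  proof (rule A.subgroupI)
    show "?U \<subseteq> carrier (graph_Aut \<Gamma>)"
      using UA by (simp add: graph_Aut_def)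
    have "(\<lambda>x\<in>?V. x) \<in> graph_automorphisms \<Gamma>"
      by (auto simp: graph_automorphisms_def id_Bij)
    moreover have "\<forall>w\<in>nbhd \<Gamma> v. p ((\<lambda>x\<in>?V. x) w) = (\<lambda>x\<in>\<Omega>. x) (p w)" if "v \<in> ?V" for v
      using p[OF that] \<Gamma>.nbhd_subset[of v] by (auto simp: subset_iff)
    ultimately have "(\<lambda>x\<in>?V. x) \<in> ?U"
      using LD(2) unfolding universal_group_def by blast
    then show "?U \<noteq> {}" by auto
  next
    fix g assume g: "g \<in> ?U"
    then have gA: "g \<in> graph_automorphisms \<Gamma>" and gB: "g \<in> Bij ?V"
      using UA autB by auto
    have inv: "inv\<^bsub>graph_Aut \<Gamma>\<^esub> g = restrict (inv_into ?V g) ?V"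
      using group.m_inv_consistent[OF group_BijGroup subgroup_graph_automorphisms gA] inv_BijGroup[OF gB]
      by (simp add: graph_Aut_def)
    have "inv\<^bsub>graph_Aut \<Gamma>\<^esub> g \<in> graph_automorphisms \<Gamma>"
      using A.inv_closed[of g] gA by (simp add: graph_Aut_def)
    then have kA: "restrict (inv_into ?V g) ?V \<in> graph_automorphisms \<Gamma>" (is "?k \<in> _")
      by (simp add: inv)
    have "\<exists>l\<in>L. \<forall>w\<in>nbhd \<Gamma> v. p (?k w) = l (p w)" if v: "v \<in> ?V" for v
    proof -
      have gk: "g (?k x) = x" "?k x \<in> ?V" if "x \<in> ?V" for x
        using gB that by (auto simp: Bij_def bij_betw_def f_inv_into_f inv_into_into)
      obtain l where l: "l \<in> L" "\<forall>w\<in>nbhd \<Gamma> (?k v). p (g w) = l (p w)"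
        using g gk(2)[OF v] by (auto simp: universal_group_def)
      have lB: "l \<in> Bij \<Omega>" using l(1) LD(1) by auto
      have "p (?k w) = restrict (inv_into \<Omega> l) \<Omega> (p w)" if w: "w \<in> nbhd \<Gamma> v" for w
      proof -
        have wV: "w \<in> ?V" using w \<Gamma>.nbhd_subset by blast
        have kw: "?k w \<in> nbhd \<Gamma> (?k v)"
          using graph_automorphisms_nbhd[OF \<Gamma> kA v] w by blast
        then have "p w = l (p (?k w))" using l(2) gk(1)[OF wV] by metis
        moreover have "p (?k w) \<in> \<Omega>" using p[OF gk(2)[OF v]] kw by blast
        moreover have "p w \<in> \<Omega>" using p[OF v] w by blast
        ultimately show ?thesis
          using lB by (simp add: Bij_def bij_betw_def)
      qed
      then show ?thesis using LD(4)[OF l(1)] by blast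
    qed
    then show "inv\<^bsub>graph_Aut \<Gamma>\<^esub> g \<in> ?U"
      using kA by (simp add: inv universal_group_def)
  next
    fix g h assume g: "g \<in> ?U" and h: "h \<in> ?U"
    then have B: "g \<in> Bij ?V" "h \<in> Bij ?V" and A: "g \<in> graph_automorphisms \<Gamma>" "h \<in> graph_automorphisms \<Gamma>"
      using UA autB by auto
    have m: "g \<otimes>\<^bsub>graph_Aut \<Gamma>\<^esub> h = compose ?V g h"
      using B by (simp add: graph_Aut_def Bij_mult)
    have "compose ?V g h \<in> graph_automorphisms \<Gamma>"
      using A.m_closed[of g h] A unfolding m by (simp add: graph_Aut_def)
    moreover have "\<exists>l\<in>L. \<forall>w\<in>nbhd \<Gamma> v. p (compose ?V g h w) = l (p w)" if v: "v \<in> ?V" for v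
    proof -
      obtain l where l: "l \<in> L" "\<forall>w\<in>nbhd \<Gamma> v. p (h w) = l (p w)"
        using h v by (auto simp: universal_group_def)
      obtain l' where l': "l' \<in> L" "\<forall>w\<in>nbhd \<Gamma> (h v). p (g w) = l' (p w)"
        using g Bij_mem[OF B(2) v] by (auto simp: universal_group_def)
      have "p (compose ?V g h w) = compose \<Omega> l' l (p w)" if w: "w \<in> nbhd \<Gamma> v" for w
      proof -
        have "w \<in> ?V" using w \<Gamma>.nbhd_subset by blast
        moreover have "p w \<in> \<Omega>" using p[OF v] w by blast
        moreover have "h w \<in> nbhd \<Gamma> (h v)"
          using graph_automorphisms_nbhd[OF \<Gamma> A(2) v] w by blast
        ultimately show ?thesis using l l' w by (simp add: compose_eq)
      qed
      then show ?thesis using LD(3)[OF l'(1) l(1)] by blast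
    qed
    ultimately show "g \<otimes>\<^bsub>graph_Aut \<Gamma>\<^esub> h \<in> ?U"
      by (simp add: m universal_group_def)
  qed
qed

text \<open>The local action lies in \<open>L\<close> by definition of the universal group. The
  hypothesis \<open>hom\<close> supplies the rest: with \<open>l\<close> the identity it gives
  transitivity on vertices, and with \<open>v' = v\<close> it shows that every element of
  \<open>L\<close> is induced by the stabiliser of \<open>v\<close>.\<close>

lemma locally_pair_universal_group:
  assumes \<Gamma>: "pair_graph \<Gamma>" and conn: "Digraph_Component.connected (with_proj \<Gamma>)"
    and L: "subgroup L (BijGroup \<Omega>)"
    and p: "\<And>v. v \<in> pverts \<Gamma> \<Longrightarrow> bij_betw p (nbhd \<Gamma> v) \<Omega>"
    and hom: "\<And>v v' l. v \<in> pverts \<Gamma> \<Longrightarrow> v' \<in> pverts \<Gamma> \<Longrightarrow> l \<in> L \<Longrightarrow>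
      \<exists>g\<in>universal_group p L \<Gamma>. g v = v' \<and> (\<forall>w\<in>nbhd \<Gamma> v. p (g w) = l (p w))"
  shows "locally_pair \<Omega> L \<Gamma> (universal_group p L \<Gamma>)"
proof -
  interpret \<Gamma>: pair_graph \<Gamma> by fact
  let ?V = "pverts \<Gamma>"
  let ?U = "universal_group p L \<Gamma>"
  note LD = subgroup_BijGroupD[OF L]
  have sub: "subgroup ?U (graph_Aut \<Gamma>)"
    using subgroup_universal_group[OF \<Gamma> L] p by (auto simp: bij_betw_def)
  then have subB: "subgroup ?U (BijGroup ?V)"
    using group.incl_subgroup[OF group_BijGroup subgroup_graph_automorphisms]
    by (simp add: graph_Aut_def)
  have UA: "?U \<subseteq> graph_automorphisms \<Gamma>" by (auto simp: universal_group_def)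
  then have UB: "?U \<subseteq> Bij ?V" by (auto simp: graph_automorphisms_def)
  have "transitive_action (perm_group ?V ?U) ?V (\<lambda>g. g)"
  proof -
    interpret B: group "BijGroup ?V" by (rule group_BijGroup)
    interpret P: group "perm_group ?V ?U" by (rule B.subgroup_imp_group[OF subB])
    show ?thesis
    proof
      show "(\<lambda>g. g) \<in> hom (perm_group ?V ?U) (BijGroup ?V)"
        using UB by (auto simp: hom_def BijGroup_def)
      show "\<exists>g\<in>carrier (perm_group ?V ?U). g x = y" if "x \<in> ?V" "y \<in> ?V" for x y
        using hom[OF that LD(2)] by auto
    qed
  qed
  then have trans: "transitive_perm_group ?V ?U"
    using subB by (simp add: transitive_perm_group_def)
  have "perm_isomorphic (nbhd \<Gamma> v) (induced_perms (point_stab ?V ?U v) (nbhd \<Gamma> v)) \<Omega> L"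
    if v: "v \<in> ?V" for v
  proof -
    let ?N = "nbhd \<Gamma> v"
    let ?M = "induced_perms (point_stab ?V ?U v) ?N"
    define q where "q = inv_into ?N p"
    \<comment> \<open>Conjugation by the bijection \<open>p\<close> from the neighbourhood to
      \<Omega>. Restricting to \<Omega> makes the result extensional, so that it equals an element
      of \<open>L\<close> and does not merely agree with it on \<Omega>.\<close>
    define \<phi> where "\<phi> = (\<lambda>h. \<lambda>x\<in>\<Omega>. p (h (q x)))"
    have qp: "q (p w) = w" if "w \<in> ?N" for w
      using p[OF v] that by (simp add: q_def bij_betw_def)
    have pq: "p (q x) = x" "q x \<in> ?N" if "x \<in> \<Omega>" for x
      using p[OF v] that by (auto simp: q_def bij_betw_def f_inv_into_f inv_into_into)
    have pN: "p w \<in> \<Omega>" if "w \<in> ?N" for w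
      using p[OF v] that by (auto simp: bij_betw_def)
    have NV: "?N \<subseteq> ?V" by (rule \<Gamma>.nbhd_subset)
    have ps: "point_stab ?V ?U v = {g \<in> ?U. g v = v}"
      by (simp add: point_stab_def stabilizer_def)
    have M_Bij: "h \<in> Bij ?N" if h: "h \<in> ?M" for h
    proof -
      obtain g where g: "g \<in> ?U" "g v = v" "h = restrict g ?N"
        using h by (auto simp: induced_perms_def ps)
      have "g ` ?N = ?N"
        using graph_automorphisms_nbhd[OF \<Gamma> _ v, of g] g UA by auto
      moreover have "inj_on g ?N"
        using UB g(1) NV by (auto simp: Bij_def bij_betw_def intro: inj_on_subset)
      ultimately show ?thesis
        by (simp add: g(3) Bij_def bij_betw_def inj_on_restrict_eq)
    qed
    have \<phi>_eq: "\<exists>l\<in>L. \<phi> h = l \<and> (\<forall>w\<in>?N. p (h w) = l (p w))" if h: "h \<in> ?M" for h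
    proof -
      obtain g where g: "g \<in> ?U" "g v = v" "h = restrict g ?N"
        using h by (auto simp: induced_perms_def ps)
      obtain l where l: "l \<in> L" "\<forall>w\<in>?N. p (g w) = l (p w)"
        using g(1) v by (auto simp: universal_group_def)
      have "l \<in> extensional \<Omega>" using l(1) LD(1) by (auto simp: Bij_def)
      then have "\<phi> h = l"
        using l(2) pq by (auto simp: \<phi>_def g(3) fun_eq_iff extensional_def)
      then show ?thesis using l by (auto simp: g(3))
    qed
    have eqv: "p (h w) = \<phi> h (p w)" if "h \<in> ?M" "w \<in> ?N" for h w
      using \<phi>_eq[OF that(1)] that(2) by metis
    have "inj_on \<phi> ?M"
    proof (rule inj_onI)
      fix h k assume hk: "h \<in> ?M" "k \<in> ?M" "\<phi> h = \<phi> k"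
      have "h w = k w" if "w \<in> ?N" for w
      proof -
        have "p (h w) = p (k w)" using eqv[OF hk(1) that] eqv[OF hk(2) that] hk(3) by metis
        moreover have "h w \<in> ?N" "k w \<in> ?N"
          using Bij_mem[OF M_Bij[OF hk(1)] that] Bij_mem[OF M_Bij[OF hk(2)] that] by blast+
        ultimately show ?thesis using qp by metis
      qed
      then show "h = k"
        using M_Bij[OF hk(1)] M_Bij[OF hk(2)] by (intro extensionalityI[of _ ?N]) (auto simp: Bij_def)
    qed
    moreover have "\<phi> ` ?M = L"
    proof
      show "\<phi> ` ?M \<subseteq> L" using \<phi>_eq by blast
      show "L \<subseteq> \<phi> ` ?M"
      proof
        fix l assume l: "l \<in> L"
        obtain g where g: "g \<in> ?U" "g v = v" "\<forall>w\<in>?N. p (g w) = l (p w)"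
          using hom[OF v v l] by auto
        have h: "restrict g ?N \<in> ?M" using g by (auto simp: induced_perms_def ps)
        have "l \<in> extensional \<Omega>" using l LD(1) by (auto simp: Bij_def)
        then have "\<phi> (restrict g ?N) = l"
          using g(3) pq by (auto simp: \<phi>_def fun_eq_iff extensional_def)
        then show "l \<in> \<phi> ` ?M" using h by blast
      qed
    qed
    moreover have "\<phi> \<in> hom (perm_group ?N ?M) (perm_group \<Omega> L)"
    proof -
      have "\<phi> (h \<otimes>\<^bsub>BijGroup ?N\<^esub> k) = \<phi> h \<otimes>\<^bsub>BijGroup \<Omega>\<^esub> \<phi> k" if hk: "h \<in> ?M" "k \<in> ?M" for h k
      proof -
        have "\<phi> h \<in> Bij \<Omega>" "\<phi> k \<in> Bij \<Omega>"
          using \<phi>_eq[OF hk(1)] \<phi>_eq[OF hk(2)] LD(1) by blast+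
        moreover have "\<phi> (compose ?N h k) = compose \<Omega> (\<phi> h) (\<phi> k)"
        proof
          fix x show "\<phi> (compose ?N h k) x = compose \<Omega> (\<phi> h) (\<phi> k) x"
          proof (cases "x \<in> \<Omega>")
            case True
            then have "k (q x) \<in> ?N" using Bij_mem[OF M_Bij[OF hk(2)] pq(2)] by blast
            then show ?thesis
              using True pq(2)[OF True] pN[of "k (q x)"] qp[of "k (q x)"]
              by (simp add: \<phi>_def compose_def)
          qed (simp add: \<phi>_def compose_def)
        qed
        ultimately show ?thesis using M_Bij[OF hk(1)] M_Bij[OF hk(2)] by (simp add: Bij_mult)
      qed
      moreover have "\<phi> h \<in> L" if "h \<in> ?M" for h using \<phi>_eq[OF that] by auto
      ultimately show ?thesis by (simp add: hom_def)
    qed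
    ultimately have "\<phi> \<in> iso (perm_group ?N ?M) (perm_group \<Omega> L)"
      by (simp add: iso_def bij_betw_def)
    then show ?thesis
      using p[OF v] eqv unfolding perm_isomorphic_def by blast
  qed
  then show ?thesis
    using \<Gamma> conn sub trans by (simp add: locally_pair_def)
qed


subsection \<open>Components of coloured graphs\<close>

lemma finite_Bij:
  assumes "finite S"
  shows "finite (Bij S)"
proof (rule finite_subset)
  show "Bij S \<subseteq> S \<rightarrow>\<^sub>E S"
    by (auto simp: Bij_def PiE_def dest: bij_betw_apply)
  show "finite (S \<rightarrow>\<^sub>E S)"
    using assms by (intro finite_PiE)
qed

text \<open>The graph is a relation on an arbitrary type, so that a cover can be described with
  structured vertices; natural numbers enter only when a component is extracted.\<close>

locale coloured_graph =
  fixes V :: "'v set" and E :: "'v \<Rightarrow> 'v \<Rightarrow> bool" and p :: "'v \<Rightarrow> 'a"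
    and \<Omega> :: "'a set" and L :: "('a \<Rightarrow> 'a) set"
  assumes finite_V: "finite V"
    and E_V: "E u v \<Longrightarrow> u \<in> V \<and> v \<in> V"
    and E_sym: "E u v \<Longrightarrow> E v u"
    and E_irrefl: "\<not> E v v"
    and colour: "v \<in> V \<Longrightarrow> bij_betw p {w. E v w} \<Omega>"
    and L: "subgroup L (BijGroup \<Omega>)"
begin

text \<open>The maps are total functions whose values matter on \<open>V\<close> only, so they
  compose by plain composition. As \<open>V\<close> is finite, injectivity already makes them
  bijections of \<open>V\<close>.\<close>

definition auts :: "('v \<Rightarrow> 'v) set" where
  "auts = {h. h \<in> V \<rightarrow> V \<and> inj_on h V \<and> (\<forall>u\<in>V. \<forall>v\<in>V. E u v \<longleftrightarrow> E (h u) (h v)) \<and>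
     (\<forall>v\<in>V. \<exists>l\<in>L. \<forall>w. E v w \<longrightarrow> p (h w) = l (p w))}"

lemma autsI:
  assumes "\<And>v. v \<in> V \<Longrightarrow> h v \<in> V" "inj_on h V"
    and "\<And>u v. u \<in> V \<Longrightarrow> v \<in> V \<Longrightarrow> E u v \<longleftrightarrow> E (h u) (h v)"
    and "\<And>v. v \<in> V \<Longrightarrow> \<exists>l\<in>L. \<forall>w. E v w \<longrightarrow> p (h w) = l (p w)"
  shows "h \<in> auts"
  using assms unfolding auts_def by blast

lemma autsD:
  assumes "h \<in> auts"
  shows "v \<in> V \<Longrightarrow> h v \<in> V" and "inj_on h V"
    and "u \<in> V \<Longrightarrow> v \<in> V \<Longrightarrow> E (h u) (h v) \<longleftrightarrow> E u v"
    and "v \<in> V \<Longrightarrow> \<exists>l\<in>L. \<forall>w. E v w \<longrightarrow> p (h w) = l (p w)"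
  using assms unfolding auts_def by blast+

definition component :: "'v \<Rightarrow> 'v set" where
  "component v = {w. E\<^sup>*\<^sup>* v w}"

lemma component_subset: "v \<in> V \<Longrightarrow> component v \<subseteq> V"
proof
  fix w assume "v \<in> V" "w \<in> component v"
  from this(2,1) show "w \<in> V"
    unfolding component_def mem_Collect_eq by induction (auto dest: E_V)
qed

lemma component_closed: "u \<in> component v \<Longrightarrow> E u w \<Longrightarrow> w \<in> component v"
  by (simp add: component_def)

lemma component_connected: "u \<in> component v \<Longrightarrow> w \<in> component v \<Longrightarrow> E\<^sup>*\<^sup>* u w"
proof -
  assume "u \<in> component v" and w: "w \<in> component v"
  have "symp E" by (auto simp: symp_def dest: E_sym)
  then have "symp E\<^sup>*\<^sup>*" by (rule symp_rtranclp)
  then have "E\<^sup>*\<^sup>* u v" using \<open>u \<in> component v\<close> by (auto simp: component_def dest: sympD)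
  then show ?thesis using w by (simp add: component_def)
qed

text \<open>Walks are mapped to walks, so one vertex that stays in the component keeps all of it
  there.\<close>

lemma auts_component:
  assumes h: "h \<in> auts" and v: "v \<in> V" and u: "u \<in> component v" "h u \<in> component v"
    and w: "w \<in> component v"
  shows "h w \<in> component v"
proof -
  have "E\<^sup>*\<^sup>* (h u) (h w)"
    using component_connected[OF u(1) w]
  proof induction
    case (step y z)
    then have "E (h y) (h z)" using autsD(3)[OF h] E_V[OF step.hyps(2)] step.hyps(2) by blast
    with step.IH show ?case by simp
  qed simp
  then show ?thesis using u(2) by (simp add: component_def)
qed

lemma auts_compose:
  assumes "g \<in> auts" "h \<in> auts"
  shows "g \<circ> h \<in> auts"
proof -
  have "\<exists>l\<in>L. \<forall>w. E v w \<longrightarrow> p ((g \<circ> h) w) = l (p w)" if v: "v \<in> V" for v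
  proof -
    obtain l where l: "l \<in> L" "\<forall>w. E v w \<longrightarrow> p (h w) = l (p w)"
      using autsD(4)[OF assms(2) v] by blast
    have hv: "h v \<in> V" using autsD(1)[OF assms(2) v] .
    obtain l' where l': "l' \<in> L" "\<forall>w. E (h v) w \<longrightarrow> p (g w) = l' (p w)"
      using autsD(4)[OF assms(1) hv] by blast
    have "p ((g \<circ> h) w) = compose \<Omega> l' l (p w)" if w: "E v w" for w
    proof -
      have "E (h v) (h w)" using w autsD(3)[OF assms(2)] E_V[OF w] by blast
      moreover have "p w \<in> \<Omega>" using colour[OF v] w by (auto simp: bij_betw_def)
      ultimately show ?thesis using w l l' by (simp add: compose_eq)
    qed
    then show ?thesis using subgroup_BijGroupD(3)[OF L l'(1) l(1)] by blast
  qed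
  moreover have "inj_on (g \<circ> h) V"
    using autsD(1,2)[OF assms(2)] autsD(2)[OF assms(1)]
    by (blast intro: comp_inj_on inj_on_subset)
  ultimately show ?thesis
    using autsD(1,3)[OF assms(1)] autsD(1,3)[OF assms(2)] unfolding auts_def by simp
qed

text \<open>Homogeneity of the whole graph descends to a component, since an automorphism that takes
  one of its vertices to another preserves it. The last conclusion bounds stabilisers from below by
  any explicit family \<open>K\<close> fixing a vertex; restrictions are counted because different
  members of \<open>K\<close> may agree on the component.\<close>

theorem component_locally_pair:
  assumes v0: "v0 \<in> V"
    and hom: "\<And>v v' l. v \<in> V \<Longrightarrow> v' \<in> V \<Longrightarrow> l \<in> L \<Longrightarrow>
      \<exists>h\<in>auts. h v = v' \<and> (\<forall>w. E v w \<longrightarrow> p (h w) = l (p w))"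
  obtains \<Gamma> :: "nat pair_pre_digraph" and G where "locally_pair \<Omega> L \<Gamma> G"
    and "card (pverts \<Gamma>) = card (component v0)"
    and "\<And>i. i \<in> pverts \<Gamma> \<Longrightarrow> \<exists>v\<in>component v0. \<forall>K\<subseteq>auts. (\<forall>h\<in>K. h v = v) \<longrightarrow>
      card ((\<lambda>h. restrict h (component v0)) ` K) \<le> card (point_stab (pverts \<Gamma>) G i)"
proof -
  let ?C = "component v0"
  define N where "N = card ?C"
  have CV: "?C \<subseteq> V" by (rule component_subset[OF v0])
  then have fin: "finite ?C" using finite_V finite_subset by blast
  obtain d where d: "bij_betw d {..<N} ?C"
    using ex_bij_betw_nat_finite[OF fin] by (auto simp: N_def lessThan_atLeast0)
  define e where "e = inv_into {..<N} d"
  have ed: "e (d i) = i" if "i < N" for i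
    using d that by (simp add: e_def bij_betw_def)
  have de: "d (e v) = v" "e v < N" if "v \<in> ?C" for v
    using d that bij_betw_inv_into_right[OF d, of v] bij_betwE[OF bij_betw_inv_into[OF d]]
    by (auto simp: e_def)
  have dC: "d i \<in> ?C" if "i < N" for i
    using d that by (auto simp: bij_betw_def)
  then have dV: "d i \<in> V" if "i < N" for i
    using that CV by blast
  define \<Gamma> :: "nat pair_pre_digraph"
    where "\<Gamma> = \<lparr>pverts = {..<N}, parcs = {(i, j). i < N \<and> j < N \<and> E (d i) (d j)}\<rparr>"
  have verts: "pverts \<Gamma> = {..<N}"
    and arcs: "(i, j) \<in> parcs \<Gamma> \<longleftrightarrow> i < N \<and> j < N \<and> E (d i) (d j)" for i j
    by (simp_all add: \<Gamma>_def)
  have nbhd: "j \<in> nbhd \<Gamma> i \<longleftrightarrow> i < N \<and> j < N \<and> E (d i) (d j)" for i j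
    by (simp add: nbhd_def arcs)
  have graph: "pair_graph \<Gamma>"
  proof
    show "finite (parcs \<Gamma>)"
      by (rule finite_subset[of _ "{..<N} \<times> {..<N}"]) (auto simp: \<Gamma>_def)
    show "symmetric (with_proj \<Gamma>)"
      by (auto simp: symmetric_def sym_def arcs dest: E_sym)
  qed (auto simp: \<Gamma>_def E_irrefl)
  interpret \<Gamma>: pair_graph \<Gamma> by (rule graph)
  have "(i, j) \<in> (parcs \<Gamma>)\<^sup>*" if "i < N" "j < N" for i j
  proof -
    \<comment> \<open>Membership in the component is carried along the induction because
      \<open>e\<close> inverts \<open>d\<close> only there.\<close>
    have "w \<in> ?C \<and> (i, e w) \<in> (parcs \<Gamma>)\<^sup>*" if "E\<^sup>*\<^sup>* (d i) w" for w
      using that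
    proof induction
      case base
      then show ?case using \<open>i < N\<close> by (simp add: ed dC)
    next
      case (step y z)
      then have "z \<in> ?C" by (blast intro: component_closed)
      moreover have "(e y, e z) \<in> parcs \<Gamma>"
        using step calculation by (simp add: arcs de)
      ultimately show ?case using step.IH by (blast intro: rtrancl.rtrancl_into_rtrancl)
    qed
    from this[of "d j"] show ?thesis
      using component_connected dC that ed by auto
  qed
  then have conn: "Digraph_Component.connected (with_proj \<Gamma>)"
  proof -
    assume *: "\<And>i j. i < N \<Longrightarrow> j < N \<Longrightarrow> (i, j) \<in> (parcs \<Gamma>)\<^sup>*"
    have "v0 \<in> ?C" by (simp add: component_def)
    then have "0 < N" using fin by (auto simp: N_def card_gt_0_iff)
    moreover have "(i, j) \<in> rtrancl_on {..<N} ((parcs \<Gamma>)\<^sup>s)" if ij: "i < N" "j < N" for i j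
    proof (rule rtrancl_consistent_rtrancl_on)
      show "(i, j) \<in> ((parcs \<Gamma>)\<^sup>s)\<^sup>*"
        using *[OF ij] rtrancl_mono[of "parcs \<Gamma>" "(parcs \<Gamma>)\<^sup>s"] by (auto simp: symcl_def)
    qed (use ij in \<open>auto simp: symcl_def arcs\<close>)
    ultimately show ?thesis
      by (auto simp: connected_conv verts lessThan_empty_iff)
  qed
  define G where "G = universal_group (p \<circ> d) L \<Gamma>"
  \<comment> \<open>Transports a map of the component to the numbering, extensionally, as required
    of elements of \<open>Bij\<close>.\<close>
  define conj where "conj = (\<lambda>h. \<lambda>i\<in>{..<N}. e (h (d i)))"
  have conj_G: "conj h \<in> G" if h: "h \<in> auts" and u: "u \<in> ?C" "h u \<in> ?C" for h u
  proof -
    have hC: "h w \<in> ?C" if "w \<in> ?C" for w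
      using auts_component[OF h v0 u that] .
    have dc: "d (conj h i) = h (d i)" "conj h i < N" if "i < N" for i
      using that hC dC de by (auto simp: conj_def)
    have "inj_on (conj h) {..<N}"
    proof (rule inj_onI)
      fix i j assume ij: "i \<in> {..<N}" "j \<in> {..<N}" "conj h i = conj h j"
      then have "h (d i) = h (d j)" using dc by (metis lessThan_iff)
      then have "d i = d j" using inj_onD[OF autsD(2)[OF h]] ij dV by blast
      then show "i = j" using ij ed by (metis lessThan_iff)
    qed
    moreover have "conj h ` {..<N} \<subseteq> {..<N}" using dc by auto
    ultimately have "conj h ` {..<N} = {..<N}" by (intro endo_inj_surj) auto
    with \<open>inj_on (conj h) {..<N}\<close> have "conj h \<in> Bij {..<N}"
      by (auto simp: Bij_def bij_betw_def conj_def)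
    then have "conj h \<in> graph_automorphisms \<Gamma>"
      using autsD(3)[OF h] dV dc by (simp add: graph_automorphisms_def verts arcs)
    moreover have "\<exists>l\<in>L. \<forall>j\<in>nbhd \<Gamma> i. (p \<circ> d) (conj h j) = l ((p \<circ> d) j)" if i: "i < N" for i
    proof -
      obtain l where "l \<in> L" "\<forall>w. E (d i) w \<longrightarrow> p (h w) = l (p w)"
        using autsD(4)[OF h dV[OF i]] by blast
      then show ?thesis using dc by (auto simp: nbhd)
    qed
    ultimately show ?thesis by (simp add: G_def universal_group_def verts)
  qed
  have "locally_pair \<Omega> L \<Gamma> G"
    unfolding G_def
  proof (rule locally_pair_universal_group[OF graph conn L])
    fix i assume "i \<in> pverts \<Gamma>"
    then have i: "i < N" by (simp add: verts)
    have "d ` nbhd \<Gamma> i = {w. E (d i) w}"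
    proof
      show "{w. E (d i) w} \<subseteq> d ` nbhd \<Gamma> i"
      proof
        fix w assume w: "w \<in> {w. E (d i) w}"
        then have "w \<in> ?C" using component_closed dC[OF i] by blast
        then have "w = d (e w)" "e w \<in> nbhd \<Gamma> i" using w i by (simp_all add: de nbhd)
        then show "w \<in> d ` nbhd \<Gamma> i" by blast
      qed
    qed (auto simp: nbhd)
    moreover have "inj_on d (nbhd \<Gamma> i)"
      using d by (auto simp: bij_betw_def nbhd intro!: inj_on_subset[of d "{..<N}"])
    ultimately have "bij_betw d (nbhd \<Gamma> i) {w. E (d i) w}" by (simp add: bij_betw_def)
    then show "bij_betw (p \<circ> d) (nbhd \<Gamma> i) \<Omega>"
      using colour[OF dV[OF i]] bij_betw_trans by blast
  next
    fix i j l assume "i \<in> pverts \<Gamma>" "j \<in> pverts \<Gamma>" and l: "l \<in> L"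
    then have ij: "i < N" "j < N" by (simp_all add: verts)
    obtain h where h: "h \<in> auts" "h (d i) = d j" "\<forall>w. E (d i) w \<longrightarrow> p (h w) = l (p w)"
      using hom[OF dV[OF ij(1)] dV[OF ij(2)] l] by blast
    have hC: "h w \<in> ?C" if "w \<in> ?C" for w
      using auts_component[OF h(1) v0 dC[OF ij(1)] _ that] h(2) dC[OF ij(2)] by simp
    have "conj h \<in> universal_group (p \<circ> d) L \<Gamma>"
      using conj_G[OF h(1) dC[OF ij(1)]] h(2) dC[OF ij(2)] by (simp add: G_def)
    moreover have "conj h i = j"
      using ij h(2) ed by (simp add: conj_def)
    moreover have "(p \<circ> d) (conj h k) = l ((p \<circ> d) k)" if "k \<in> nbhd \<Gamma> i" for k
      using that h(3) by (simp add: nbhd conj_def de hC dC)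
    ultimately show "\<exists>g\<in>universal_group (p \<circ> d) L \<Gamma>. g i = j \<and>
        (\<forall>w\<in>nbhd \<Gamma> i. (p \<circ> d) (g w) = l ((p \<circ> d) w))" by blast
  qed
  moreover have "card (pverts \<Gamma>) = card ?C" by (simp add: verts N_def)
  moreover have "\<exists>v\<in>?C. \<forall>K\<subseteq>auts. (\<forall>h\<in>K. h v = v) \<longrightarrow>
      card ((\<lambda>h. restrict h ?C) ` K) \<le> card (point_stab (pverts \<Gamma>) G i)"
    if "i \<in> pverts \<Gamma>" for i
  proof (intro bexI[of _ "d i"] allI impI)
    have i: "i < N" using that by (simp add: verts)
    show "d i \<in> ?C" by (rule dC[OF i])
    fix K assume K: "K \<subseteq> auts" "\<forall>h\<in>K. h (d i) = d i"
    have hC: "h w \<in> ?C" if "h \<in> K" "w \<in> ?C" for h w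
    proof -
      have "h \<in> auts" "h (d i) = d i" using K that(1) by auto
      then show ?thesis using auts_component[OF _ v0 dC[OF i] _ that(2)] dC[OF i] by simp
    qed
    have ps: "point_stab (pverts \<Gamma>) G i = {g \<in> G. g i = i}"
      by (simp add: point_stab_def stabilizer_def)
    have "G \<subseteq> Bij {..<N}"
      by (auto simp: G_def universal_group_def graph_automorphisms_def verts)
    then have "finite (point_stab (pverts \<Gamma>) G i)"
      unfolding ps using finite_Bij[of "{..<N}"] finite_subset by fastforce
    \<comment> \<open>\<open>conj\<close> reads \<open>h\<close> on the component only, so it
      factors through the restriction; on restrictions it is injective.\<close>
    moreover have conj_restrict: "conj (restrict h ?C) = conj h" for h
      by (auto simp: conj_def dC)
    have "conj h \<in> point_stab (pverts \<Gamma>) G i" if "h \<in> K" for h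
    proof -
      have "h \<in> auts" "h (d i) = d i" using K that by auto
      then show ?thesis
        using conj_G[of h "d i"] dC[OF i] ed[OF i] i by (simp add: ps) (simp add: conj_def)
    qed
    then have "conj ` (\<lambda>h. restrict h ?C) ` K \<subseteq> point_stab (pverts \<Gamma>) G i"
      by (auto simp: conj_restrict)
    moreover have "inj_on conj ((\<lambda>h. restrict h ?C) ` K)"
    proof (rule inj_onI, clarify)
      fix h k assume hk: "h \<in> K" "k \<in> K" "conj (restrict h ?C) = conj (restrict k ?C)"
      have "h w = k w" if w: "w \<in> ?C" for w
      proof -
        have "conj h (e w) = conj k (e w)" using hk by (simp add: conj_restrict)
        then have "e (h w) = e (k w)" using w by (simp add: conj_def de)
        then show ?thesis using hC hk w de by metis
      qed
      then show "restrict h ?C = restrict k ?C" by (auto simp: restrict_def)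
    qed
    ultimately show "card ((\<lambda>h. restrict h ?C) ` K) \<le> card (point_stab (pverts \<Gamma>) G i)"
      by (intro card_inj_on_le[of conj])
  qed
  ultimately show ?thesis using that by blast
qed

end


subsection \<open>The cover\<close>

text \<open>\<open>R\<close> stands for lying in the same block, and \<open>kernel\<close> is the
  stabiliser hypothesis moved by conjugation to the block of each point. The bound on the modulus
  \<open>m\<close> makes 0 and 1 distinct residues, so that the voltages are their own
  representatives.\<close>

locale block_cover =
  fixes \<Omega> :: "'a set" and L :: "('a \<Rightarrow> 'a) set" and R :: "'a \<Rightarrow> 'a \<Rightarrow> bool" and m :: int
  assumes finite_\<Omega>: "finite \<Omega>"
    and subgroup_L: "subgroup L (BijGroup \<Omega>)"
    and transitive_L: "x \<in> \<Omega> \<Longrightarrow> y \<in> \<Omega> \<Longrightarrow> \<exists>g\<in>L. g x = y"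
    and R_refl: "x \<in> \<Omega> \<Longrightarrow> R x x"
    and R_sym: "x \<in> \<Omega> \<Longrightarrow> y \<in> \<Omega> \<Longrightarrow> R x y \<Longrightarrow> R y x"
    and R_trans: "x \<in> \<Omega> \<Longrightarrow> y \<in> \<Omega> \<Longrightarrow> z \<in> \<Omega> \<Longrightarrow> R x y \<Longrightarrow> R y z \<Longrightarrow> R x z"
    and R_invariant: "g \<in> L \<Longrightarrow> x \<in> \<Omega> \<Longrightarrow> y \<in> \<Omega> \<Longrightarrow> R (g x) (g y) \<longleftrightarrow> R x y"
    and kernel: "x \<in> \<Omega> \<Longrightarrow>
      \<exists>k\<in>L. (\<exists>y\<in>\<Omega>. R x y \<and> k y \<noteq> y) \<and> (\<forall>y\<in>\<Omega>. \<not> R x y \<longrightarrow> k y = y)"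
    and R_nontrivial: "\<exists>x\<in>\<Omega>. \<exists>y\<in>\<Omega>. \<not> R x y"
    and m: "2 \<le> m"
begin

lemma L_mem: "g \<in> L \<Longrightarrow> x \<in> \<Omega> \<Longrightarrow> g x \<in> \<Omega>"
  by (rule Bij_mem[OF subsetD[OF subgroup_BijGroupD(1)[OF subgroup_L]]])

lemma L_inj:
  assumes "g \<in> L" "x \<in> \<Omega>" "y \<in> \<Omega>" "g x = g y"
  shows "x = y"
proof -
  have "inj_on g \<Omega>"
    using assms(1) subgroup_BijGroupD(1)[OF subgroup_L] by (auto simp: Bij_def bij_betw_def)
  then show ?thesis using assms(2-4) by (meson inj_onD)
qed

abbreviation labels :: "('a \<times> 'a \<Rightarrow> int) set" where
  "labels \<equiv> \<Omega> \<times> \<Omega> \<rightarrow>\<^sub>E {0..<m}"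

text \<open>The entries are the side of the bipartite base graph, the point of \<Omega> below the
  vertex, and the element of the voltage group, with residues represented in
  \<open>{0..<m}\<close>.\<close>

definition V :: "(bool \<times> 'a \<times> ('a \<times> 'a \<Rightarrow> int)) set" where
  "V = UNIV \<times> \<Omega> \<times> labels"

text \<open>
  Labels are functions on \<open>\<Omega> \<times> \<Omega>\<close> rather than on pairs of blocks, so the voltage of the arc from
  \<open>w\<close> to \<open>w'\<close> is the indicator of the product of their blocks. The label of a vertex with \<open>i = True\<close> is stored negated and transposed, which makes the adjacency
  relation symmetric under exchanging the two sides.
\<close>

definition voltage :: "'a \<Rightarrow> 'a \<Rightarrow> 'a \<Rightarrow> 'a \<Rightarrow> int" where
  "voltage w w' a b = (if R a w \<and> R b w' then 1 else 0)"

fun E :: "bool \<times> 'a \<times> ('a \<times> 'a \<Rightarrow> int) \<Rightarrow> bool \<times> 'a \<times> ('a \<times> 'a \<Rightarrow> int) \<Rightarrow> bool" where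
  "E (i, w, x) (j, w', y) \<longleftrightarrow> w \<in> \<Omega> \<and> x \<in> labels \<and> w' \<in> \<Omega> \<and> y \<in> labels \<and> i \<noteq> j \<and>
     (\<forall>a\<in>\<Omega>. \<forall>b\<in>\<Omega>. (x (a, b) + y (b, a)) mod m = voltage w w' a b)"

abbreviation p :: "bool \<times> 'a \<times> ('a \<times> 'a \<Rightarrow> int) \<Rightarrow> 'a" where
  "p v \<equiv> fst (snd v)"

text \<open>The label of the only neighbour over \<open>w'\<close> of a vertex with point
  \<open>w\<close> and label \<open>x\<close>, obtained by solving the congruence in
  \<open>E\<close> for \<open>y\<close>.\<close>

definition opp :: "'a \<Rightarrow> ('a \<times> 'a \<Rightarrow> int) \<Rightarrow> 'a \<Rightarrow> 'a \<times> 'a \<Rightarrow> int" where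
  "opp w x w' = (\<lambda>(b, a)\<in>\<Omega> \<times> \<Omega>. (voltage w w' a b - x (a, b)) mod m)"

lemma opp_labels: "opp w x w' \<in> labels"
  using m by (auto simp: opp_def)

lemma label_range: "x \<in> labels \<Longrightarrow> a \<in> \<Omega> \<Longrightarrow> b \<in> \<Omega> \<Longrightarrow> x (a, b) mod m = x (a, b)"
  by (auto simp: PiE_def Pi_def)

lemma labels_eqI:
  assumes "x \<in> labels" "y \<in> labels" "\<And>a b. a \<in> \<Omega> \<Longrightarrow> b \<in> \<Omega> \<Longrightarrow> x (a, b) = y (a, b)"
  shows "x = y"
  using assms by (intro PiE_ext[of x "\<Omega> \<times> \<Omega>" "\<lambda>_. {0..<m}" y]) auto

text \<open>Representatives in \<open>{0..<m}\<close> are unique, so the congruence determines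
  \<open>y\<close>. Thus every vertex has exactly one neighbour over each point of \<Omega> on the
  other side, which makes \<open>p\<close> bijective on neighbourhoods.\<close>

lemma E_iff:
  "E (i, w, x) (j, w', y) \<longleftrightarrow> w \<in> \<Omega> \<and> x \<in> labels \<and> w' \<in> \<Omega> \<and> j = (\<not> i) \<and> y = opp w x w'"
proof
  assume E: "E (i, w, x) (j, w', y)"
  have "y = opp w x w'"
  proof (rule labels_eqI[OF _ opp_labels])
    fix b a assume "b \<in> \<Omega>" "a \<in> \<Omega>"
    moreover from this E have "voltage w w' a b = (x (a, b) + y (b, a)) mod m" by simp
    moreover have "y (b, a) mod m = y (b, a)" using calculation E label_range by simp
    ultimately show "y (b, a) = opp w x w' (b, a)" by (simp add: opp_def mod_diff_left_eq)
  qed (use E in simp)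
  then show "w \<in> \<Omega> \<and> x \<in> labels \<and> w' \<in> \<Omega> \<and> j = (\<not> i) \<and> y = opp w x w'"
    using E by auto
next
  assume "w \<in> \<Omega> \<and> x \<in> labels \<and> w' \<in> \<Omega> \<and> j = (\<not> i) \<and> y = opp w x w'"
  then show "E (i, w, x) (j, w', y)"
    using opp_labels m by (simp add: opp_def mod_add_right_eq) (simp add: voltage_def)
qed

lemma finite_verts: "finite V"
  unfolding V_def using finite_\<Omega> by (intro finite_cartesian_product finite_PiE) auto

sublocale coloured_graph V E p \<Omega> L
proof (rule coloured_graph.intro)
  show "u \<in> V \<and> v \<in> V" if "E u v" for u v
    using that by (cases u; cases v) (auto simp: V_def)
  show "E v u" if "E u v" for u v
    using that by (cases u; cases v) (auto simp: voltage_def add.commute)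
  show "\<not> E v v" for v by (cases v) auto
  show "bij_betw p {u. E v u} \<Omega>" if "v \<in> V" for v
  proof -
    obtain i w x where v: "v = (i, w, x)" by (cases v)
    show ?thesis
      by (rule bij_betw_byWitness[where f' = "\<lambda>w'. (\<not> i, w', opp w x w')"])
         (use that in \<open>auto simp: v V_def E_iff simp del: E.simps\<close>)
  qed
qed (simp_all add: finite_verts subgroup_L)

lemma V_iff: "(i, w, x) \<in> V \<longleftrightarrow> w \<in> \<Omega> \<and> x \<in> labels"
  by (simp add: V_def)

lemma component_mem:
  "v \<in> V \<Longrightarrow> (i, w, x) \<in> component v \<Longrightarrow> w \<in> \<Omega> \<and> x \<in> labels"
  using component_subset V_iff by blast

section \<open>Automorphisms of the cover\<close>

definition flip :: "bool \<times> 'a \<times> ('a \<times> 'a \<Rightarrow> int) \<Rightarrow> bool \<times> 'a \<times> ('a \<times> 'a \<Rightarrow> int)" where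
  "flip = (\<lambda>(i, w, x). (\<not> i, w, x))"

lemma id_local: "v \<in> V \<Longrightarrow> (\<And>w. w \<in> V \<Longrightarrow> p (h w) = p w) \<Longrightarrow>
  \<exists>l\<in>L. \<forall>w. E v w \<longrightarrow> p (h w) = l (p w)"
proof (rule bexI[OF _ subgroup_BijGroupD(2)[OF subgroup_L]], intro allI impI)
  fix w assume "\<And>w. w \<in> V \<Longrightarrow> p (h w) = p w" "E v w"
  then show "p (h w) = (\<lambda>x\<in>\<Omega>. x) (p w)"
    using E_V[of v w] by (cases w) (simp add: V_iff)
qed

lemma flip_auts: "flip \<in> auts"
proof (rule autsI)
  show "\<exists>l\<in>L. \<forall>w. E v w \<longrightarrow> p (flip w) = l (p w)" if "v \<in> V" for v
    by (rule id_local[OF that]) (auto simp: flip_def)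
qed (auto simp: flip_def V_iff inj_on_def)

text \<open>The deck transformations of the cover. As labels on the side \<open>True\<close> are
  stored negated and transposed, the same translation appears there with the opposite sign and
  transposed; the two contributions cancel in the adjacency condition.\<close>

definition translate ::
    "('a \<times> 'a \<Rightarrow> int) \<Rightarrow> bool \<times> 'a \<times> ('a \<times> 'a \<Rightarrow> int) \<Rightarrow> bool \<times> 'a \<times> ('a \<times> 'a \<Rightarrow> int)" where
  "translate t = (\<lambda>(i, w, x). (i, w, \<lambda>(a, b)\<in>\<Omega> \<times> \<Omega>.
     (x (a, b) + (if i then t (a, b) else - t (b, a))) mod m))"

lemma translate_auts: "translate t \<in> auts"
proof -
  have "\<exists>l\<in>L. \<forall>w. E v w \<longrightarrow> p (translate t w) = l (p w)" if "v \<in> V" for v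
    by (rule id_local[OF that]) (auto simp: translate_def)
  moreover have V: "translate t \<in> V \<rightarrow> V"
    using m by (auto simp: V_def translate_def)
  moreover have "inj_on (translate t) V"
  proof (rule inj_onI)
    fix u v assume uv: "u \<in> V" "v \<in> V" "translate t u = translate t v"
    obtain i w x where u: "u = (i, w, x)" by (cases u)
    obtain y where v: "v = (i, w, y)"
      using uv(3) by (cases v) (auto simp: u translate_def)
    have "x = y"
    proof (rule labels_eqI)
      fix a b assume ab: "a \<in> \<Omega>" "b \<in> \<Omega>"
      define s where "s = (if i then t (a, b) else - t (b, a))"
      have "snd (snd (translate t u)) (a, b) = snd (snd (translate t v)) (a, b)"
        using uv(3) by simp
      then have "(x (a, b) + s) mod m = (y (a, b) + s) mod m"
        using ab unfolding u v translate_def by (simp add: s_def split del: if_split)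
      then have "(x (a, b) + s - s) mod m = (y (a, b) + s - s) mod m"
        by (rule mod_diff_cong) simp
      then show "x (a, b) = y (a, b)"
        using uv ab label_range by (simp add: u v V_iff)
    qed (use uv in \<open>simp_all add: u v V_iff\<close>)
    then show "u = v" by (simp add: u v)
  qed
  moreover have "E u v \<longleftrightarrow> E (translate t u) (translate t v)" if uv: "u \<in> V" "v \<in> V" for u v
  proof -
    obtain i w x j w' y where eq: "u = (i, w, x)" "v = (j, w', y)" by (cases u; cases v)
    have tV: "translate t u \<in> V" "translate t v \<in> V" using V uv by auto
    have "((x (a, b) + (if i then t (a, b) else - t (b, a))) mod m +
           (y (b, a) + (if j then t (b, a) else - t (a, b))) mod m) mod m = (x (a, b) + y (b, a)) mod m"
      if "i \<noteq> j" for a b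
      using that by (auto simp: mod_add_eq)
    then show ?thesis
      using uv tV by (auto simp: eq translate_def V_iff)
  qed
  ultimately show ?thesis by (simp add: auts_def)
qed

text \<open>The lift of a pair of elements of \<open>L\<close>, one for each side. The first
  coordinate of a label refers to blocks of the vertex's own side and the second to blocks of the
  other side, hence \<open>f i\<close> and \<open>f (\<not> i)\<close>; the inverses occur because
  functions are being moved.\<close>

definition permute ::
    "(bool \<Rightarrow> 'a \<Rightarrow> 'a) \<Rightarrow> bool \<times> 'a \<times> ('a \<times> 'a \<Rightarrow> int) \<Rightarrow> bool \<times> 'a \<times> ('a \<times> 'a \<Rightarrow> int)" where
  "permute f = (\<lambda>(i, w, x). (i, f i w, \<lambda>(a, b)\<in>\<Omega> \<times> \<Omega>.
     x (inv_into \<Omega> (f i) a, inv_into \<Omega> (f (\<not> i)) b)))"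

text \<open>Voltages are defined through \<open>R\<close>, which \<open>L\<close> preserves, so
  moving points and labels together preserves adjacency. The neighbours of a vertex on side
  \<open>i\<close> lie on the other side, so its local action is
  \<open>f (\<not> i)\<close>.\<close>

lemma permute_auts:
  assumes f: "\<And>i. f i \<in> L"
  shows "permute f \<in> auts"
proof -
  have bij: "bij_betw (f i) \<Omega> \<Omega>" for i
    using f subgroup_BijGroupD(1)[OF subgroup_L] by (auto simp: Bij_def)
  have inv_mem: "inv_into \<Omega> (f i) a \<in> \<Omega>" if "a \<in> \<Omega>" for i a
    using bij_betw_apply[OF bij_betw_inv_into[OF bij] that] .
  have inv_f: "inv_into \<Omega> (f i) (f i a) = a" if "a \<in> \<Omega>" for i a
    using bij_betw_inv_into_left[OF bij that] .
  have all_f: "(\<forall>a\<in>\<Omega>. P a) \<longleftrightarrow> (\<forall>a\<in>\<Omega>. P (f i a))" for P i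
    using bij[of i] unfolding bij_betw_def by (metis imageE imageI)
  have "\<exists>l\<in>L. \<forall>w. E v w \<longrightarrow> p (permute f w) = l (p w)" for v
  proof -
    obtain i w x where v: "v = (i, w, x)" by (cases v)
    show ?thesis
      by (rule bexI[OF _ f[of "\<not> i"]]) (auto simp: v permute_def)
  qed
  moreover have V: "permute f \<in> V \<rightarrow> V"
    using L_mem[OF f]
    by (auto simp: V_iff permute_def restrict_PiE_iff inv_mem split: prod.splits
        simp del: atLeastLessThan_iff intro!: PiE_mem[of _ "\<Omega> \<times> \<Omega>" "\<lambda>_. {0..<m}"])
  moreover have "inj_on (permute f) V"
  proof (rule inj_onI)
    fix u v assume uv: "u \<in> V" "v \<in> V" "permute f u = permute f v"
    obtain i w x where u: "u = (i, w, x)" by (cases u)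
    obtain w' y where v: "v = (i, w', y)" and "f i w = f i w'"
      using uv(3) by (cases v) (auto simp: u permute_def)
    then have w: "w = w'" using L_inj[OF f[of i], of w w'] uv(1,2) by (simp add: u V_iff)
    have "x = y"
    proof (rule labels_eqI)
      fix a b assume ab: "a \<in> \<Omega>" "b \<in> \<Omega>"
      have "snd (snd (permute f u)) (f i a, f (\<not> i) b) = snd (snd (permute f v)) (f i a, f (\<not> i) b)"
        using uv(3) by simp
      then show "x (a, b) = y (a, b)"
        using ab by (simp add: u v permute_def inv_f L_mem f)
    qed (use uv in \<open>simp_all add: u v V_iff\<close>)
    then show "u = v" by (simp add: u v w)
  qed
  moreover have "E u v \<longleftrightarrow> E (permute f u) (permute f v)" if uv: "u \<in> V" "v \<in> V" for u v
  proof -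
    obtain i w x j w' y where eq: "u = (i, w, x)" "v = (j, w', y)" by (cases u; cases v)
    have tV: "permute f u \<in> V" "permute f v \<in> V" using V uv by auto
    show ?thesis
    proof (cases "i = j")
      case False
      then have j: "j = (\<not> i)" by simp
      obtain x' y' where p: "permute f u = (i, f i w, x')" "permute f v = (\<not> i, f (\<not> i) w', y')"
        and x': "\<And>a b. a \<in> \<Omega> \<Longrightarrow> b \<in> \<Omega> \<Longrightarrow> x' (f i a, f (\<not> i) b) = x (a, b)"
        and y': "\<And>a b. a \<in> \<Omega> \<Longrightarrow> b \<in> \<Omega> \<Longrightarrow> y' (f (\<not> i) b, f i a) = y (b, a)"
        by (simp add: eq j permute_def inv_f L_mem f)
      have ww: "w \<in> \<Omega>" "w' \<in> \<Omega>" using uv by (simp_all add: eq V_iff)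
      \<comment> \<open>Reindexing by the bijections \<open>f i\<close> and
        \<open>f (\<not> i)\<close> undoes the inverses in \<open>permute\<close>.\<close>
      have "(\<forall>a\<in>\<Omega>. \<forall>b\<in>\<Omega>. (x' (a, b) + y' (b, a)) mod m = voltage (f i w) (f (\<not> i) w') a b) \<longleftrightarrow>
        (\<forall>a\<in>\<Omega>. \<forall>b\<in>\<Omega>. (x' (f i a, f (\<not> i) b) + y' (f (\<not> i) b, f i a)) mod m =
           voltage (f i w) (f (\<not> i) w') (f i a) (f (\<not> i) b))"
        by (subst all_f[of _ i], subst (2) all_f[of _ "\<not> i"]) (rule refl)
      also have "\<dots> \<longleftrightarrow> (\<forall>a\<in>\<Omega>. \<forall>b\<in>\<Omega>. (x (a, b) + y (b, a)) mod m = voltage w w' a b)"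
        by (simp add: x' y' voltage_def R_invariant f ww)
      finally show ?thesis
        using uv tV unfolding p by (simp add: eq j V_iff)
    qed (simp add: eq permute_def)
  qed
  ultimately show ?thesis by (simp add: auts_def)
qed

text \<open>Three corrections in turn: \<open>permute\<close> with \<open>g\<close> on the side of
  \<open>v\<close> and \<open>l\<close> on the side of its neighbours adjusts the point and fixes
  the local action, \<open>translate\<close> adjusts the label, and \<open>flip\<close> adjusts the
  side. The last two leave \<open>p\<close> unchanged, so the local action stays
  \<open>l\<close>.\<close>

lemma homogeneous:
  assumes v: "v \<in> V" and v': "v' \<in> V" and l: "l \<in> L"
  shows "\<exists>h\<in>auts. h v = v' \<and> (\<forall>u. E v u \<longrightarrow> p (h u) = l (p u))"
proof -
  obtain i w x i' w' x' where eq: "v = (i, w, x)" "v' = (i', w', x')" by (cases v; cases v')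
  obtain g where g: "g \<in> L" "g w = w'"
    using transitive_L v v' by (auto simp: eq V_iff)
  define P where "P = permute (\<lambda>j. if j = i then g else l)"
  have P: "P \<in> auts" unfolding P_def using g l by (intro permute_auts) simp
  obtain x1 where Pv: "P v = (i, w', x1)" by (simp add: P_def permute_def eq g)
  \<comment> \<open>The solution for the label difference; the two cases compensate the sign and
    transposition in \<open>translate\<close>.\<close>
  define t where "t = (\<lambda>(a, b). if i then x' (a, b) - x1 (a, b) else x1 (b, a) - x' (b, a))"
  have Tv: "translate t (i, w', x1) = (i, w', x')"
  proof -
    have "snd (snd (translate t (i, w', x1))) = x'"
    proof (rule labels_eqI)
      have "translate t (P v) \<in> V" using autsD(1) translate_auts P v by blast
      then show "snd (snd (translate t (i, w', x1))) \<in> labels"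
        unfolding Pv by (metis V_iff prod.collapse)
      show x': "x' \<in> labels" using v' by (simp add: eq V_iff)
      show "snd (snd (translate t (i, w', x1))) (a, b) = x' (a, b)" if "a \<in> \<Omega>" "b \<in> \<Omega>" for a b
        using that label_range[OF x' that] by (simp add: translate_def t_def)
    qed
    then show ?thesis by (simp add: translate_def)
  qed
  define h where "h = (if i = i' then translate t \<circ> P else flip \<circ> (translate t \<circ> P))"
  have "h \<in> auts"
    using P translate_auts flip_auts by (simp add: h_def auts_compose)
  moreover have "h v = v'"
  proof (cases "i = i'")
    case True
    then have "h v = translate t (P v)" by (simp add: h_def)
    then show ?thesis using True unfolding Pv Tv eq(2) by simp
  next
    case False
    then have "h v = flip (translate t (P v))" by (simp add: h_def)
    then show ?thesis using False unfolding Pv Tv eq(2) by (auto simp: flip_def)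
  qed
  moreover have "p (h u) = p (P u)" for u
    by (auto simp: h_def translate_def flip_def split: prod.split)
  moreover have "p (P u) = l (p u)" if "E v u" for u
    using that by (cases u) (auto simp: P_def permute_def eq)
  ultimately show ?thesis by auto
qed

subsection \<open>Independent twists of the fibres\<close>

definition cls :: "'a \<Rightarrow> 'a set" where
  "cls w = {y \<in> \<Omega>. R w y}"

lemma cls_eq_iff: "w \<in> \<Omega> \<Longrightarrow> y \<in> \<Omega> \<Longrightarrow> cls w = cls y \<longleftrightarrow> R w y"
  using R_refl R_sym R_trans unfolding cls_def by blast

text \<open>Indexed by the block and not by a point, so that one and the same permutation is applied
  to the whole block.\<close>

definition kap :: "'a set \<Rightarrow> 'a \<Rightarrow> 'a" where
  "kap c = (SOME k. k \<in> L \<and> (\<exists>y\<in>c. k y \<noteq> y) \<and> (\<forall>y\<in>\<Omega> - c. k y = y))"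

lemma kap:
  assumes "w \<in> \<Omega>"
  shows "kap (cls w) \<in> L" and "\<exists>y\<in>cls w. kap (cls w) y \<noteq> y"
    and "\<And>y. y \<in> \<Omega> \<Longrightarrow> cls y \<noteq> cls w \<Longrightarrow> kap (cls w) y = y"
proof -
  have "\<exists>k. k \<in> L \<and> (\<exists>y\<in>cls w. k y \<noteq> y) \<and> (\<forall>y\<in>\<Omega> - cls w. k y = y)"
    using kernel[OF assms] unfolding cls_def by blast
  from someI_ex[OF this] have *: "kap (cls w) \<in> L \<and> (\<exists>y\<in>cls w. kap (cls w) y \<noteq> y) \<and>
      (\<forall>y\<in>\<Omega> - cls w. kap (cls w) y = y)"
    unfolding kap_def .
  then show "kap (cls w) \<in> L" "\<exists>y\<in>cls w. kap (cls w) y \<noteq> y" by blast+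
  show "kap (cls w) y = y" if "y \<in> \<Omega>" "cls y \<noteq> cls w" for y
    using * that cls_eq_iff[OF assms that(1)] by (auto simp: cls_def)
qed

text \<open>An image outside the block would be a fixed point, and by injectivity it would then
  coincide with \<open>w\<close> itself.\<close>

lemma kap_cls:
  assumes w: "w \<in> \<Omega>"
  shows "kap (cls w) w \<in> \<Omega>" and "cls (kap (cls w) w) = cls w"
proof -
  show mem: "kap (cls w) w \<in> \<Omega>" using L_mem kap(1) w by blast
  show "cls (kap (cls w) w) = cls w"
  proof (rule ccontr)
    assume ne: "cls (kap (cls w) w) \<noteq> cls w"
    then have "kap (cls w) (kap (cls w) w) = kap (cls w) w"
      using kap(3)[OF w mem] by blast
    then have "kap (cls w) w = w" by (rule L_inj[OF kap(1)[OF w] mem w])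
    then show False using ne by simp
  qed
qed

text \<open>The permutations chosen for different blocks have disjoint supports, so any set of them
  can be multiplied into one element of \<open>L\<close>. These products are the local actions of
  the twists below.\<close>

lemma kap_product:
  assumes "finite T" "T \<subseteq> cls ` \<Omega>"
  shows "\<exists>l\<in>L. \<forall>w\<in>\<Omega>. l w = (if cls w \<in> T then kap (cls w) w else w)"
  using assms
proof induction
  case empty
  show ?case
    by (rule bexI[OF _ subgroup_BijGroupD(2)[OF subgroup_L]]) simp
next
  case (insert c T)
  then obtain l where l: "l \<in> L" "\<forall>w\<in>\<Omega>. l w = (if cls w \<in> T then kap (cls w) w else w)"
    by auto
  obtain w0 where w0: "w0 \<in> \<Omega>" "c = cls w0" using insert.prems by auto
  have "compose \<Omega> (kap c) l w = (if cls w \<in> insert c T then kap (cls w) w else w)"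
    if w: "w \<in> \<Omega>" for w
  proof (cases "cls w = c")
    case True
    then show ?thesis using l(2) w insert.hyps(2) by (simp add: compose_eq)
  next
    case False
    have "l w \<in> \<Omega>" "cls (l w) = cls w" using l w kap_cls by auto
    then have "kap c (l w) = l w" using kap(3)[OF w0(1)] False w0(2) by metis
    then show ?thesis using l(2) w False by (simp add: compose_eq)
  qed
  moreover have "compose \<Omega> (kap c) l \<in> L"
    using subgroup_BijGroupD(3)[OF subgroup_L] kap(1)[OF w0(1)] l(1) w0(2) by blast
  ultimately show ?case by blast
qed

text \<open>Names the set of all vertices with the same side, block and label; such vertices are
  twins, by the next results on voltages.\<close>

definition fibre :: "bool \<times> 'a \<times> ('a \<times> 'a \<Rightarrow> int) \<Rightarrow> bool \<times> 'a set \<times> ('a \<times> 'a \<Rightarrow> int)" where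
  "fibre = (\<lambda>(i, w, x). (i, cls w, x))"

definition twist :: "(bool \<times> 'a set \<times> ('a \<times> 'a \<Rightarrow> int)) set \<Rightarrow>
    bool \<times> 'a \<times> ('a \<times> 'a \<Rightarrow> int) \<Rightarrow> bool \<times> 'a \<times> ('a \<times> 'a \<Rightarrow> int)" where
  "twist S = (\<lambda>(i, w, x). (i, if fibre (i, w, x) \<in> S then kap (cls w) w else w, x))"

lemma voltage_cls:
  assumes "w \<in> \<Omega>" "w' \<in> \<Omega>" "y \<in> \<Omega>" "y' \<in> \<Omega>" "a \<in> \<Omega>" "b \<in> \<Omega>" "cls w = cls y" "cls w' = cls y'"
  shows "voltage w w' a b = voltage y y' a b"
  using assms by (simp add: voltage_def cls_eq_iff[symmetric])

text \<open>Voltages see only blocks, so moving points within their blocks, with sides and labels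
  kept, does not affect adjacency.\<close>

lemma E_cls:
  assumes "w \<in> \<Omega>" "w' \<in> \<Omega>" "y \<in> \<Omega>" "y' \<in> \<Omega>" "cls w = cls y" "cls w' = cls y'"
  shows "E (i, w, x) (j, w', z) \<longleftrightarrow> E (i, y, x) (j, y', z)"
  using assms voltage_cls[OF assms(1-4) _ _ assms(5,6)] by auto

text \<open>Adjacency survives because points only move inside their blocks. The neighbours of a
  vertex over one block all carry the same label, hence form a single fibre, which is twisted
  entirely or not at all; so the local action is a product of elements \<open>kap c\<close> over
  some set of blocks.\<close>

lemma twist_auts: "twist S \<in> auts"
proof (rule autsI)
  have tw: "\<exists>w'. twist S (i, w, x) = (i, w', x) \<and> w' \<in> \<Omega> \<and> cls w' = cls w" if "w \<in> \<Omega>" for i w x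
    using kap_cls[OF that] that by (auto simp: twist_def)
  show "twist S v \<in> V" if "v \<in> V" for v
  proof -
    obtain i w x where v: "v = (i, w, x)" by (cases v)
    show ?thesis using tw[of w i x] that by (auto simp: v V_iff)
  qed
  show "inj_on (twist S) V"
  proof (rule inj_onI)
    fix u v assume uv: "u \<in> V" "v \<in> V" "twist S u = twist S v"
    obtain i w x j y z where eq: "u = (i, w, x)" "v = (j, y, z)" by (cases u; cases v)
    have wy: "w \<in> \<Omega>" "y \<in> \<Omega>" using uv by (simp_all add: eq V_iff)
    then have *: "j = i" "z = x" "cls w = cls y"
      using uv(3) tw[of w i x] tw[of y j z] by (auto simp: eq)
    have "w = y"
    proof (cases "fibre u \<in> S")
      case True
      then have "kap (cls w) w = kap (cls w) y"
        using uv(3) * by (simp add: eq twist_def fibre_def)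
      then show ?thesis by (rule L_inj[OF kap(1)[OF wy(1)] wy])
    next
      case False
      then show ?thesis using uv(3) * by (simp add: eq twist_def fibre_def)
    qed
    then show "u = v" by (simp add: eq *)
  qed
  show "E u v \<longleftrightarrow> E (twist S u) (twist S v)" if uv: "u \<in> V" "v \<in> V" for u v
  proof -
    obtain i w x j y z where eq: "u = (i, w, x)" "v = (j, y, z)" by (cases u; cases v)
    have wy: "w \<in> \<Omega>" "y \<in> \<Omega>" using uv by (simp_all add: eq V_iff)
    obtain w' y' where w': "twist S u = (i, w', x)" "w' \<in> \<Omega>" "cls w' = cls w"
      and y': "twist S v = (j, y', z)" "y' \<in> \<Omega>" "cls y' = cls y"
      using tw[OF wy(1)] tw[OF wy(2)] unfolding eq by metis
    show ?thesis
      unfolding w'(1) y'(1) unfolding eq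
      by (rule E_cls) (use wy w' y' in simp_all)
  qed
  show "\<exists>l\<in>L. \<forall>u. E v u \<longrightarrow> p (twist S u) = l (p u)" if "v \<in> V" for v
  proof -
    obtain i w x where v: "v = (i, w, x)" by (cases v)
    have w: "w \<in> \<Omega>" using that by (simp add: v V_iff)
    \<comment> \<open>The blocks over which the fibre of neighbours of \<open>v\<close> belongs to
      \<open>S\<close>.\<close>
    define T where "T = {cls y | y. y \<in> \<Omega> \<and> (\<not> i, cls y, opp w x y) \<in> S}"
    have "T \<subseteq> cls ` \<Omega>" by (auto simp: T_def)
    moreover from this have "finite T" using finite_\<Omega> finite_surj by blast
    ultimately obtain l where l: "l \<in> L" "\<forall>y\<in>\<Omega>. l y = (if cls y \<in> T then kap (cls y) y else y)"
      using kap_product by blast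
    have opp_cls: "opp w x y = opp w x z" if "y \<in> \<Omega>" "z \<in> \<Omega>" "cls y = cls z" for y z
      unfolding opp_def using voltage_cls[OF w that(1) w that(2) _ _ refl that(3)]
      by (auto simp: restrict_def fun_eq_iff)
    have "p (twist S u) = l (p u)" if "E v u" for u
    proof -
      obtain y where u: "u = (\<not> i, y, opp w x y)" and y: "y \<in> \<Omega>"
        using \<open>E v u\<close> by (cases u) (auto simp: v E_iff simp del: E.simps)
      have "cls y \<in> T \<longleftrightarrow> (\<not> i, cls y, opp w x y) \<in> S"
      proof
        assume "cls y \<in> T"
        then obtain z where z: "cls y = cls z" "z \<in> \<Omega>" "(\<not> i, cls z, opp w x z) \<in> S"
          unfolding T_def by blast
        then show "(\<not> i, cls y, opp w x y) \<in> S" using opp_cls[OF y z(2,1)] by simp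
      next
        assume "(\<not> i, cls y, opp w x y) \<in> S"
        then show "cls y \<in> T" using y unfolding T_def by blast
      qed
      then show ?thesis using l(2) y by (simp add: u twist_def fibre_def)
    qed
    then show ?thesis using l(1) by blast
  qed
qed

section \<open>Counting fibres and twists in a component\<close>

text \<open>Twins have a common neighbour, so a component contains every fibre that it
  meets.\<close>

lemma twin_component:
  assumes "v \<in> V" "(i, w, x) \<in> component v" "y \<in> \<Omega>" "cls y = cls w"
  shows "(i, y, x) \<in> component v"
proof -
  have w: "w \<in> \<Omega>" "x \<in> labels" using component_mem[OF assms(1,2)] by blast+
  let ?z = "(\<not> i, w, opp w x w)"
  have "E (i, w, x) ?z" using w by (simp add: E_iff del: E.simps)
  moreover from this have "E (i, y, x) ?z"
    using E_cls[OF w(1) w(1) assms(3) w(1) assms(4)[symmetric] refl] by blast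
  ultimately show ?thesis
    using component_closed[OF component_closed[OF assms(2)]] E_sym by blast
qed

text \<open>A vertex is recovered from its fibre and its point of \<Omega>, so the number of fibres
  is at least a fixed fraction of the number of vertices.\<close>

lemma card_component_le:
  assumes "v \<in> V"
  shows "card (component v) \<le> card (fibre ` component v) * card \<Omega>"
proof -
  have C: "component v \<subseteq> V" by (rule component_subset[OF assms])
  then have fin: "finite (component v)" using finite_V finite_subset by blast
  have "component v \<subseteq> (\<lambda>((i, c, x), w). (i, w, x)) ` (fibre ` component v \<times> \<Omega>)"
  proof
    fix u assume u: "u \<in> component v"
    obtain i w x where eq: "u = (i, w, x)" by (cases u)
    have "w \<in> \<Omega>" using component_mem[OF assms] u eq by blast
    then have "(fibre u, w) \<in> fibre ` component v \<times> \<Omega>" using u by blast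
    then show "u \<in> (\<lambda>((i, c, x), w). (i, w, x)) ` (fibre ` component v \<times> \<Omega>)"
      by (rule rev_image_eqI) (simp add: eq fibre_def)
  qed
  moreover have "finite (fibre ` component v \<times> \<Omega>)" using fin finite_\<Omega> by simp
  ultimately have "card (component v) \<le> card (fibre ` component v \<times> \<Omega>)"
    by (rule surj_card_le[rotated])
  then show ?thesis by (simp add: card_cartesian_product)
qed

text \<open>A vertex and a neighbour lie on different sides. The bound lets one fibre be discarded
  at the cost of at most half of them.\<close>

lemma card_fibres_ge:
  assumes "v \<in> V"
  shows "2 \<le> card (fibre ` component v)"
proof -
  obtain i w x where v: "v = (i, w, x)" by (cases v)
  let ?u = "(\<not> i, w, opp w x w)"
  have "E v ?u" using assms by (simp add: v V_iff E_iff del: E.simps)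
  moreover have vC: "v \<in> component v" by (simp add: component_def)
  ultimately have "?u \<in> component v" by (rule component_closed[rotated])
  then have "{fibre v, fibre ?u} \<subseteq> fibre ` component v" using vC by blast
  moreover have "fibre v \<noteq> fibre ?u" by (simp add: v fibre_def)
  moreover have "finite (component v)"
    using component_subset[OF assms] finite_V finite_subset by blast
  ultimately show ?thesis using card_mono[of "fibre ` component v" "{fibre v, fibre ?u}"] by simp
qed

text \<open>Twisting only fibres other than that of \<open>v\<close> fixes \<open>v\<close>. The set
  of twisted fibres can be read off on the component, since every fibre meeting it lies in it and
  contains a vertex moved by the corresponding \<open>kap\<close>.\<close>

lemma card_twists:
  assumes v0: "v0 \<in> V" and v: "v \<in> component v0"
  obtains K where "K \<subseteq> auts" "\<forall>h\<in>K. h v = v"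
    "card ((\<lambda>h. restrict h (component v0)) ` K) = 2 ^ (card (fibre ` component v0) - 1)"
proof
  let ?C = "component v0"
  let ?F = "fibre ` ?C - {fibre v}"
  let ?K = "twist ` Pow ?F"
  have C: "?C \<subseteq> V" by (rule component_subset[OF v0])
  then have fin: "finite (fibre ` ?C)" using finite_V finite_subset by blast
  show "?K \<subseteq> auts" using twist_auts by blast
  show "\<forall>h\<in>?K. h v = v" by (cases v) (auto simp: twist_def)
  have sub: "S \<subseteq> T" if S: "S \<subseteq> ?F" and eq: "restrict (twist S) ?C = restrict (twist T) ?C" for S T
  proof
    fix f assume f: "f \<in> S"
    then obtain u where u: "u \<in> ?C" "f = fibre u" using S by blast
    obtain i w x where "u = (i, w, x)" by (cases u)
    then have w: "(i, w, x) \<in> ?C" "f = (i, cls w, x)" using u by (simp_all add: fibre_def)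
    have w\<Omega>: "w \<in> \<Omega>" using component_mem[OF v0 w(1)] by blast
    obtain y where y: "y \<in> cls w" "kap (cls w) y \<noteq> y" using kap(2)[OF w\<Omega>] by blast
    then have y\<Omega>: "y \<in> \<Omega>" "cls y = cls w" using cls_eq_iff[OF w\<Omega>] by (auto simp: cls_def)
    have "(i, y, x) \<in> ?C" by (rule twin_component[OF v0 w(1) y\<Omega>])
    then have "twist S (i, y, x) = twist T (i, y, x)"
      using eq by (metis restrict_apply')
    moreover have "twist S (i, y, x) = (i, kap (cls w) y, x)"
      using f unfolding w(2) by (simp add: twist_def fibre_def y\<Omega>(2))
    ultimately have "twist T (i, y, x) \<noteq> (i, y, x)" using y(2) by (metis prod.inject)
    then show "f \<in> T"
      unfolding w(2) by (simp add: twist_def fibre_def y\<Omega>(2) split: if_splits)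
  qed
  then have "inj_on (\<lambda>S. restrict (twist S) ?C) (Pow ?F)"
    by (intro inj_onI equalityI) (simp_all add: sub)
  then have "card ((\<lambda>S. restrict (twist S) ?C) ` Pow ?F) = 2 ^ card ?F"
    using fin by (simp add: card_image card_Pow)
  moreover have "card ?F = card (fibre ` ?C) - 1"
    using fin v by (simp add: card_Diff_singleton)
  ultimately show "card ((\<lambda>h. restrict h ?C) ` ?K) = 2 ^ (card (fibre ` ?C) - 1)"
    by (simp add: image_image)
qed

section \<open>Components of unbounded size\<close>

text \<open>
  The walk goes once around a 4-cycle through the blocks of \<open>w\<close> and \<open>w'\<close>; only its first arc has a
  nonzero voltage at \<open>(w, w)\<close>.
\<close>

lemma component_step:
  assumes "v \<in> V" and C: "(i, w, x) \<in> component v" and w': "w' \<in> \<Omega>" "\<not> R w w'"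
  shows "\<exists>x'. (i, w, x') \<in> component v \<and> x' (w, w) = (x (w, w) - 1) mod m"
proof -
  have w: "w \<in> \<Omega>" "x \<in> labels" using component_mem[OF assms(1) C] by blast+
  define x1 where "x1 = opp w x w"
  define x2 where "x2 = opp w x1 w'"
  define x3 where "x3 = opp w' x2 w'"
  define x4 where "x4 = opp w' x3 w"
  have lab: "x1 \<in> labels" "x2 \<in> labels" "x3 \<in> labels"
    by (simp_all only: x1_def x2_def x3_def opp_labels)
  have "E (i, w, x) (\<not> i, w, x1)" "E (\<not> i, w, x1) (i, w', x2)"
    "E (i, w', x2) (\<not> i, w', x3)" "E (\<not> i, w', x3) (i, w, x4)"
    using w w'(1) lab by (simp_all only: E_iff x1_def x2_def x3_def x4_def) simp_all
  then have "(i, w, x4) \<in> component v" using C component_closed by blast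
  moreover have "x4 (w, w) = (x (w, w) - 1) mod m"
  proof -
    have opp_w: "opp u y u' (w, w) = (voltage u u' w w - y (w, w)) mod m" for u u' y
      using w(1) by (simp add: opp_def)
    have vol: "voltage w w w w = 1" "voltage w w' w w = 0" "voltage w' w' w w = 0" "voltage w' w w w = 0"
      using w(1) w'(2) R_refl by (simp_all add: voltage_def)
    have neg: "(0 - (a mod m)) mod m = (- a) mod m" for a
      by (simp add: mod_minus_eq)
    show ?thesis
      unfolding x4_def x3_def x2_def x1_def opp_w vol neg by simp
  qed
  ultimately show ?thesis by blast
qed

text \<open>Repeating the walk from the zero label lowers the value at \<open>(w, w)\<close> by one
  modulo \<open>m\<close> each time, so all \<open>m\<close> residues occur in the
  component.\<close>

lemma large_component:
  obtains v where "v \<in> V" "nat m \<le> card (component v)"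
proof -
  obtain w w' where w: "w \<in> \<Omega>" and w': "w' \<in> \<Omega>" "\<not> R w w'" using R_nontrivial by blast
  define v :: "bool \<times> 'a \<times> ('a \<times> 'a \<Rightarrow> int)" where "v = (False, w, \<lambda>_\<in>\<Omega> \<times> \<Omega>. 0)"
  have v: "v \<in> V" using w m by (simp add: v_def V_iff)
  have "\<exists>x. (False, w, x) \<in> component v \<and> x (w, w) = (- int n) mod m" for n
  proof (induction n)
    case 0
    have "(False, w, \<lambda>_\<in>\<Omega> \<times> \<Omega>. 0) \<in> component v" unfolding component_def v_def by blast
    then show ?case using w by (intro exI conjI) (assumption, simp)
  next
    case (Suc n)
    then obtain x where x: "(False, w, x) \<in> component v" "x (w, w) = (- int n) mod m" by blast
    obtain x' where "(False, w, x') \<in> component v" "x' (w, w) = (x (w, w) - 1) mod m"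
      using component_step[OF v x(1) w'] by blast
    moreover have "((- int n) mod m - 1) mod m = (- int (Suc n)) mod m"
    proof -
      have "- int (Suc n) = - int n - 1" by simp
      then show ?thesis by (simp only: mod_diff_left_eq)
    qed
    ultimately show ?case using x(2) by metis
  qed
  note walk = this
  have "{0..<m} \<subseteq> (\<lambda>(i, y, x). x (w, w)) ` component v"
  proof
    fix j assume j: "j \<in> {0..<m}"
    \<comment> \<open>Since the value decreases, residue \<open>j\<close> is reached after
      \<open>m - j\<close> rounds; for \<open>j = 0\<close> this is a full turn.\<close>
    obtain x where "(False, w, x) \<in> component v" "x (w, w) = (- int (nat (m - j))) mod m"
      using walk by blast
    moreover have "(- int (nat (m - j))) mod m = j"
      using j by simp
    ultimately show "j \<in> (\<lambda>(i, y, x). x (w, w)) ` component v" by force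
  qed
  moreover have "finite (component v)"
    using component_subset[OF v] finite_V finite_subset by blast
  ultimately have "card {0..<m} \<le> card (component v)" by (intro surj_card_le)
  then show ?thesis using that v by simp
qed

section \<open>The exponential lower bound for vertex stabilisers\<close>

theorem exponential_pair:
  obtains \<Gamma> :: "nat pair_pre_digraph" and G where "locally_pair \<Omega> L \<Gamma> G"
    and "nat m \<le> card (pverts \<Gamma>)"
    and "\<And>i. i \<in> pverts \<Gamma> \<Longrightarrow>
      (2 powr (1 / (2 * card \<Omega>))) ^ card (pverts \<Gamma>) \<le> real (card (point_stab (pverts \<Gamma>) G i))"
proof -
  obtain v0 where v0: "v0 \<in> V" and large: "nat m \<le> card (component v0)" by (rule large_component)
  let ?C = "component v0"
  define F where "F = card (fibre ` ?C)"
  have F: "2 \<le> F" "card ?C \<le> F * card \<Omega>"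
    using card_fibres_ge[OF v0] card_component_le[OF v0] by (simp_all add: F_def)
  obtain \<Gamma> :: "nat pair_pre_digraph" and G where 1: "locally_pair \<Omega> L \<Gamma> G"
    and 2: "card (pverts \<Gamma>) = card ?C"
    and 3: "\<And>i. i \<in> pverts \<Gamma> \<Longrightarrow> \<exists>v\<in>?C. \<forall>K\<subseteq>auts. (\<forall>h\<in>K. h v = v) \<longrightarrow>
      card ((\<lambda>h. restrict h ?C) ` K) \<le> card (point_stab (pverts \<Gamma>) G i)"
    using component_locally_pair[OF v0 homogeneous] by blast
  have "0 < card \<Omega>" using F(1,2) large m by (cases "card \<Omega>") auto
  moreover have "real (card ?C) \<le> real F * real (card \<Omega>)"
    using F(2) by (metis of_nat_le_iff of_nat_mult)
  \<comment> \<open>Source of the base \<open>2 powr (1 / (2 * card \<Omega>))\<close>: there are at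
    least \<open>card ?C / card \<Omega>\<close> fibres, and the further factor 2 absorbs the loss
    from \<open>F\<close> to \<open>F - 1\<close>.\<close>
  ultimately have "card ?C / (2 * card \<Omega>) \<le> F / 2"
    by (simp add: divide_simps)
  also have "\<dots> \<le> real (F - 1)" using F(1) by (simp add: of_nat_diff)
  finally have "(2::real) powr (card ?C / (2 * card \<Omega>)) \<le> 2 powr real (F - 1)" by simp
  then have bound: "(2 powr (1 / (2 * card \<Omega>))) ^ card ?C \<le> (2::real) ^ (F - 1)"
    by (simp add: powr_realpow[symmetric] powr_powr)
  have "(2 powr (1 / (2 * card \<Omega>))) ^ card (pverts \<Gamma>) \<le> real (card (point_stab (pverts \<Gamma>) G i))"
    if i: "i \<in> pverts \<Gamma>" for i
  proof -
    obtain v where v: "v \<in> ?C" and le: "\<forall>K\<subseteq>auts. (\<forall>h\<in>K. h v = v) \<longrightarrow>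
      card ((\<lambda>h. restrict h ?C) ` K) \<le> card (point_stab (pverts \<Gamma>) G i)"
      using 3[OF i] by blast
    have "2 ^ (F - 1) \<le> card (point_stab (pverts \<Gamma>) G i)"
      using card_twists[OF v0 v] le unfolding F_def by metis
    then have "(2::real) ^ (F - 1) \<le> real (card (point_stab (pverts \<Gamma>) G i))"
      by (metis of_nat_le_iff of_nat_numeral of_nat_power)
    then show ?thesis unfolding 2 by (rule order_trans[OF bound])
  qed
  then show ?thesis using that 1 2 large by simp
qed

end


subsection \<open>Block systems\<close>

definition same_block :: "('a \<Rightarrow> 'a) set \<Rightarrow> 'a set \<Rightarrow> 'a \<Rightarrow> 'a \<Rightarrow> bool" where
  "same_block L B x y \<longleftrightarrow> (\<exists>g\<in>L. x \<in> g ` B \<and> y \<in> g ` B)"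

text \<open>The product of the inverse of \<open>g\<close> with \<open>h\<close> sends a point of
  \<open>B\<close> into \<open>B\<close>, so it preserves \<open>B\<close>; applying
  \<open>g\<close> gives the claim.\<close>

lemma block_translates_eq:
  assumes L: "subgroup L (BijGroup \<Omega>)" and B: "block \<Omega> L B"
    and "g \<in> L" "h \<in> L" "g ` B \<inter> h ` B \<noteq> {}"
  shows "g ` B = h ` B"
proof -
  have B\<Omega>: "B \<subseteq> \<Omega>" using B by (simp add: block_def)
  have h\<Omega>: "h x \<in> \<Omega>" if "x \<in> \<Omega>" for x
    using subgroup_BijGroupD(1)[OF L] \<open>h \<in> L\<close> that Bij_mem by (metis subsetD)
  obtain g' where g': "g' \<in> L" "\<And>x. x \<in> \<Omega> \<Longrightarrow> g' (g x) = x" "\<And>x. x \<in> \<Omega> \<Longrightarrow> g (g' x) = x"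
    using subgroup_BijGroup_inverse[OF L \<open>g \<in> L\<close>] by blast
  let ?k = "compose \<Omega> g' h"
  have k: "?k x = g' (h x)" if "x \<in> B" for x
    using that B\<Omega> by (auto simp: compose_eq)
  obtain b b' where b: "b \<in> B" "b' \<in> B" "g b = h b'" using assms(5) by blast
  then have "?k b' = b" using k g'(2) B\<Omega> by (metis subsetD)
  then have "?k ` B \<inter> B \<noteq> {}" using b by blast
  moreover have "?k \<in> L" by (rule subgroup_BijGroupD(3)[OF L g'(1) \<open>h \<in> L\<close>])
  ultimately have "?k ` B = B" using B unfolding block_def by blast
  then have "g ` ?k ` B = g ` B" by simp
  moreover have "g (?k x) = h x" if "x \<in> B" for x
    using k[OF that] g'(3) h\<Omega> that B\<Omega> by auto
  ultimately show ?thesis by (simp add: image_image cong: image_cong)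
qed

theorem theorem1p2:
  fixes \<Omega> :: "'a set" and L :: "('a \<Rightarrow> 'a) set" and B :: "'a set"
  assumes "finite \<Omega>"
    and "transitive_perm_group \<Omega> L"
    and "nontrivial_block \<Omega> L B"
    and "pointwise_stab L (\<Omega> - B) \<noteq> {\<one>\<^bsub>BijGroup \<Omega>\<^esub>}"
  shows "exponential_graph_growth \<Omega> L"
proof -
  have L: "subgroup L (BijGroup \<Omega>)" and act: "transitive_action (perm_group \<Omega> L) \<Omega> (\<lambda>g. g)"
    using assms(2) by (simp_all add: transitive_perm_group_def)
  have trans: "\<exists>g\<in>L. g x = y" if "x \<in> \<Omega>" "y \<in> \<Omega>" for x y
    using transitive_action.unique_orbit[OF act that] by simp
  have B: "block \<Omega> L B" and "card B < card \<Omega>"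
    using assms(3) by (simp_all add: nontrivial_block_def)
  then have B\<Omega>: "B \<subseteq> \<Omega>" "B \<noteq> {}" "B \<noteq> \<Omega>" by (auto simp: block_def)
  note LD = subgroup_BijGroupD[OF L]
  have mem: "g x \<in> \<Omega>" if "g \<in> L" "x \<in> \<Omega>" for g x
    using LD(1) that Bij_mem by (metis subsetD)
  have inv: "R (g x) (g y)" if "g \<in> L" "R x y" "R = same_block L B" for g x y R
  proof -
    obtain h b b' where h: "h \<in> L" "b \<in> B" "b' \<in> B" "x = h b" "y = h b'"
      using \<open>R x y\<close> \<open>R = _\<close> by (auto simp: same_block_def)
    have "compose \<Omega> g h b = g x" "compose \<Omega> g h b' = g y"
      using h B\<Omega>(1) by (auto simp: compose_eq)
    then have "g x \<in> compose \<Omega> g h ` B" "g y \<in> compose \<Omega> g h ` B" using h(2,3) by force+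
    then show ?thesis using LD(3)[OF \<open>g \<in> L\<close> h(1)] \<open>R = _\<close> by (auto simp: same_block_def)
  qed
  \<comment> \<open>A nontrivial element of the pointwise stabiliser and a point that it moves; this
    point necessarily lies in \<open>B\<close>.\<close>
  obtain \<kappa> z where \<kappa>: "\<kappa> \<in> L" "\<And>x. x \<in> \<Omega> - B \<Longrightarrow> \<kappa> x = x" and z: "z \<in> \<Omega>" "\<kappa> z \<noteq> z"
  proof -
    have "(\<lambda>x\<in>\<Omega>. x) \<in> pointwise_stab L (\<Omega> - B)" using LD(2) by (simp add: pointwise_stab_def)
    then obtain \<kappa> where k: "\<kappa> \<in> pointwise_stab L (\<Omega> - B)" "\<kappa> \<noteq> (\<lambda>x\<in>\<Omega>. x)"
      using assms(4) by (auto simp: BijGroup_def)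
    then have "\<kappa> \<in> L" by (simp add: pointwise_stab_def)
    then have "\<kappa> \<in> extensional \<Omega>" using LD(1) by (auto simp: Bij_def)
    then obtain z where "z \<in> \<Omega>" "\<kappa> z \<noteq> z"
      using k(2) by (metis extensionalityI restrict_apply' restrict_extensional)
    then show thesis using that k(1) by (auto simp: pointwise_stab_def)
  qed
  have cover: "block_cover \<Omega> L (same_block L B) m" if "2 \<le> m" for m
  proof
    show "same_block L B x x" if x: "x \<in> \<Omega>" for x
    proof -
      obtain b where b: "b \<in> B" using B\<Omega> by blast
      then obtain g where "g \<in> L" "g b = x" using trans x B\<Omega> by blast
      then show ?thesis using b by (auto simp: same_block_def)
    qed
    show "same_block L B x z" if "same_block L B x y" "same_block L B y z" for x y z
    proof -
      obtain g h where "g \<in> L" "x \<in> g ` B" "y \<in> g ` B" "h \<in> L" "y \<in> h ` B" "z \<in> h ` B"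
        using \<open>same_block L B x y\<close> \<open>same_block L B y z\<close> unfolding same_block_def by blast
      moreover from this have "g ` B = h ` B" by (intro block_translates_eq[OF L B]) auto
      ultimately show ?thesis unfolding same_block_def by blast
    qed
    show "same_block L B (g x) (g y) \<longleftrightarrow> same_block L B x y" if "g \<in> L" "x \<in> \<Omega>" "y \<in> \<Omega>" for g x y
    proof
      obtain g' where g': "g' \<in> L" "\<And>x. x \<in> \<Omega> \<Longrightarrow> g' (g x) = x"
        using subgroup_BijGroup_inverse[OF L \<open>g \<in> L\<close>] by blast
      show "same_block L B x y" if "same_block L B (g x) (g y)"
        using inv[OF g'(1) that refl] g'(2) \<open>x \<in> \<Omega>\<close> \<open>y \<in> \<Omega>\<close> by simp
    qed (rule inv[OF \<open>g \<in> L\<close> _ refl])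
    show "\<exists>k\<in>L. (\<exists>y\<in>\<Omega>. same_block L B x y \<and> k y \<noteq> y) \<and> (\<forall>y\<in>\<Omega>. \<not> same_block L B x y \<longrightarrow> k y = y)"
      if x: "x \<in> \<Omega>" for x
    proof -
      have zB: "z \<in> B" using \<kappa>(2) z by blast
      obtain g where g: "g \<in> L" "g z = x" using trans x z(1) by blast
      obtain g' where g': "g' \<in> L" "\<And>x. x \<in> \<Omega> \<Longrightarrow> g' (g x) = x" "\<And>x. x \<in> \<Omega> \<Longrightarrow> g (g' x) = x"
        using subgroup_BijGroup_inverse[OF L g(1)] by blast
      define k where "k = compose \<Omega> g (compose \<Omega> \<kappa> g')"
      have k: "k y = g (\<kappa> (g' y))" if "y \<in> \<Omega>" for y
        using that by (simp add: k_def compose_eq)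
      show ?thesis
      proof (intro bexI[of _ k] conjI ballI impI)
        show "k \<in> L" unfolding k_def using LD(3) g(1) \<kappa>(1) g'(1) by blast
        have "k x = g (\<kappa> z)" using k[OF x] g'(2)[OF z(1)] g(2) by simp
        moreover have "g (\<kappa> z) \<noteq> g z" using g'(2) z mem[OF \<kappa>(1) z(1)] by metis
        ultimately have "k x \<noteq> x" using g(2) by simp
        moreover have "same_block L B x x" using g zB unfolding same_block_def by blast
        ultimately show "\<exists>y\<in>\<Omega>. same_block L B x y \<and> k y \<noteq> y" using x by blast
        fix y assume y: "y \<in> \<Omega>" "\<not> same_block L B x y"
        have "g' y \<notin> B"
        proof
          assume "g' y \<in> B"
          then have "y \<in> g ` B" using g'(3)[OF y(1)] by force
          then show False using y(2) g zB unfolding same_block_def by blast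
        qed
        then have "\<kappa> (g' y) = g' y" using \<kappa>(2) mem[OF g'(1) y(1)] by blast
        then show "k y = y" using k[OF y(1)] g'(3)[OF y(1)] by simp
      qed
    qed
    show "\<exists>x\<in>\<Omega>. \<exists>y\<in>\<Omega>. \<not> same_block L B x y"
    proof -
      \<comment> \<open>The only translate of \<open>B\<close> that contains a point of
        \<open>B\<close> is \<open>B\<close> itself, so no point outside \<open>B\<close> shares a
        block with one inside.\<close>
      obtain x y where xy: "x \<in> B" "y \<in> \<Omega>" "y \<notin> B" using B\<Omega> by blast
      have "\<not> same_block L B x y"
      proof
        assume "same_block L B x y"
        then obtain g where g: "g \<in> L" "x \<in> g ` B" "y \<in> g ` B" by (auto simp: same_block_def)
        then have "g ` B = B" using B xy(1) unfolding block_def by blast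
        then show False using g(3) xy(3) by simp
      qed
      then show ?thesis using xy B\<Omega>(1) by blast
    qed
  qed (use assms(1) L that trans in \<open>auto simp: same_block_def subgroup_def\<close>)
  define c where "c = 2 powr (1 / real (2 * card \<Omega>))"
  have "1 < c" using assms(1) B\<Omega> unfolding c_def by (intro gr_one_powr) (auto simp: card_gt_0_iff)
  \<comment> \<open>Graph and group are bundled into one pair so that a single choice over
    \<open>n\<close> yields both sequences.\<close>
  have "\<exists>\<Gamma>G. locally_pair \<Omega> L (fst \<Gamma>G :: nat pair_pre_digraph) (snd \<Gamma>G) \<and>
      n \<le> card (pverts (fst \<Gamma>G)) \<and>
      (\<forall>v\<in>pverts (fst \<Gamma>G). c ^ card (pverts (fst \<Gamma>G)) \<le>
         real (card (point_stab (pverts (fst \<Gamma>G)) (snd \<Gamma>G) v)))" for n :: nat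
  proof -
    \<comment> \<open>The modulus \<open>n + 2\<close> satisfies the lower bound on \<open>m\<close>
      and forces at least \<open>n\<close> vertices.\<close>
    have "block_cover \<Omega> L (same_block L B) (int n + 2)" by (rule cover) simp
    note pair = block_cover.exponential_pair[OF this, folded c_def]
    show ?thesis
    proof (rule pair)
      fix \<Gamma> :: "nat pair_pre_digraph" and G
      assume "locally_pair \<Omega> L \<Gamma> G" "nat (int n + 2) \<le> card (pverts \<Gamma>)"
        "\<And>i. i \<in> pverts \<Gamma> \<Longrightarrow> c ^ card (pverts \<Gamma>) \<le> real (card (point_stab (pverts \<Gamma>) G i))"
      then show ?thesis by (intro exI[of _ "(\<Gamma>, G)"]) simp
    qed
  qed
  then obtain \<Gamma>G where \<Gamma>G: "\<And>n. locally_pair \<Omega> L (fst (\<Gamma>G n) :: nat pair_pre_digraph) (snd (\<Gamma>G n))"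
    "\<And>n. n \<le> card (pverts (fst (\<Gamma>G n)))"
    "\<And>n. \<forall>v\<in>pverts (fst (\<Gamma>G n)). c ^ card (pverts (fst (\<Gamma>G n))) \<le>
         real (card (point_stab (pverts (fst (\<Gamma>G n))) (snd (\<Gamma>G n)) v))"
    by metis
  have "filterlim (\<lambda>n. card (pverts (fst (\<Gamma>G n)))) at_top sequentially"
    by (rule filterlim_at_top_mono[OF filterlim_ident]) (simp add: \<Gamma>G(2))
  then show ?thesis
    unfolding exponential_graph_growth_def
    using \<Gamma>G \<open>1 < c\<close>
    by (intro exI[of _ "\<lambda>n. fst (\<Gamma>G n)"] exI[of _ "\<lambda>n. snd (\<Gamma>G n)"]) blast
qed

end
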